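(* Let $X$ be a locally convex space over $\mathbf K$, where $\mathbf K$ is $\mathbf R$, $\mathbf C$, or a non-Archimedean spherically complete field with non-trivial norm. If $(X,2^X_\delta)$ is $\kappa$-normable, then $(L(X),2^{L(X)}_\delta)$ is conditionally $\kappa$-normable.
   Context: For a topological space $X$, $2^X_o$ is the family of all canonical closed (regular closed) subsets of $X$ (closures of their interiors) and $2^X_\delta$ is the family of all closed $G_\delta$-subsets of $X$. Let $S_X$ be $2^X_o$ or $2^X_\delta$, where $X$ is a topological vector space over $\mathbf K$. A $\kappa$-norm on $(X,S_X)=X\times S_X$ is a non-negative function $\rho(x,C)$ of $x\in X$, $C\in S_X$, such that: (N1) $\rho(x,C)=0$ iff $x\in C$; (N2) if $C\subset C'$ then $\rho(x,C)\ge\rho(x,C')$; (N3) $\rho(x,C)$ is uniformly continuous in $x\in X$ for each fixed $C\in S_X$; (N4) for each increasing transfinite sequence $\{C_\alpha\}$ in $S_X$ with $C:=\mathrm{cl}(\bigcup_\alpha C_\alpha)\in S_X$, $\rho(x,C)=\inf_\alpha\rho(x,C_\alpha)$; (N5)(a) $\rho(x+y,\mathrm{cl}(C_1+C_2))\le\rho(x,C_1)+\rho(y,C_2)$ and (b) $\rho(x,C_1)\le\rho(x,C_2)+\bar\rho(C_2,C_1)$, where $\bar\rho(C_2,C_1):=\sup_{x\in C_2}\rho(x,C_1)$ (in the non-Archimedean case with the maximum instead of the sum on the right-hand sides); (N6) $\rho(\lambda x,\lambda C)=|\lambda|\rho(x,C)$ for each $0\ne\lambda\in\mathbf K$; (N7)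 $\rho(x+y,y+C)=\rho(x,C)$; (N8) (if $\emptyset$ is considered as an element of $S_X$) $\rho(x,\emptyset)=\infty$, and $\rho(x,C)<\infty$ for each $x\in X$ and $\emptyset\ne C\in S_X$. $(X,S_X)$ is $\kappa$-normable if it admits a $\kappa$-norm. $\mathsf O(X)$ is the space of continuous linear operators $X\to X$, and $L(X)$ is the uniform space of linear topological homeomorphisms $S:X\to X$, with the topology induced from $\mathsf O(X)$ whose base (at zero) is given by the sets $W(U,V):=\{S\in\mathsf O(X): S(U)\subset V\}$, where $U,V$ range over a base $\mathsf V$ of neighbourhoods of zero in $X$. $(L(X),2^{L(X)}_\delta)$ is conditionally $\kappa$-normable if there is a non-negative function $\rho(A,S)$ of $A\in L(X)$, $S\in 2^{L(X)}_\delta$ satisfying (N1)–(N8) (with $L(X)$ in place of $X$ and $2^{L(X)}_\delta$ in place of $S_X$), the axioms being required whenever the results of the operations involved, namely $(A,B)\mapsto A+B$, $(\lambda,A)\mapsto\lambda A$, $(S_1,S_2)\mapsto\mathrm{cl}(S_1+S_2)$, $(A,S)\mapsto A+S$, $(\lambda,S)\mapsto\lambda S$, and $\mathrm{cl}(\bigcup_\alpha S_\alpha)$ for increasing transfinite sequences, belong to $L(X)$ or $2^{L(X)}_\delta$ respectively, where $A,B\in L(X)$, $S,S_1,S_2,S_\alpha\in 2^{L(X)}_\delta$, $0\neq\lambda\in\mathbf K$.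
   Formalization: The base of neighbourhoods of zero defining the topology of O(X) is required to make O(X) a topological vector space (such a base is proved to exist, and all such bases are covered); for an arbitrary base the claim fails, e.g. X = R with all open neighbourhoods of 0. *)

theory Defs
  imports "HOL-Analysis.Analysis" "HOL-Library.Function_Algebras"
begin

section \<open>The scalar field\<close>

text \<open>
  The field is a type of class \<^class>\<open>field\<close> together with an explicit norm, so that the
  real, the complex and the non-Archimedean case are covered by one statement.
\<close>

definition absolute_value :: "('k::field \<Rightarrow> real) \<Rightarrow> bool" where
  "absolute_value nrm \<longleftrightarrow>
     (\<forall>x. 0 \<le> nrm x) \<and> (\<forall>x. nrm x = 0 \<longleftrightarrow> x = 0) \<and>
     (\<forall>x y. nrm (x * y) = nrm x * nrm y) \<and> (\<forall>x y. nrm (x + y) \<le> nrm x + nrm y)"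

definition ultrametric_norm :: "('k::field \<Rightarrow> real) \<Rightarrow> bool" where
  "ultrametric_norm nrm \<longleftrightarrow> (\<forall>x y. nrm (x + y) \<le> max (nrm x) (nrm y))"

text \<open>Isometric isomorphism with a standard normed field (instantiated with the reals and the
  complex numbers).\<close>

definition isometric_field_iso ::
    "('k::field \<Rightarrow> real) \<Rightarrow> ('k \<Rightarrow> 'r::real_normed_field) \<Rightarrow> bool" where
  "isometric_field_iso nrm \<phi> \<longleftrightarrow>
     bij \<phi> \<and> (\<forall>x y. \<phi> (x + y) = \<phi> x + \<phi> y) \<and> (\<forall>x y. \<phi> (x * y) = \<phi> x * \<phi> y) \<and>
     (\<forall>x. norm (\<phi> x) = nrm x)"

definition is_real_field :: "('k::field \<Rightarrow> real) \<Rightarrow> bool" where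
  "is_real_field nrm \<longleftrightarrow> (\<exists>\<phi> :: 'k \<Rightarrow> real. isometric_field_iso nrm \<phi>)"

definition is_complex_field :: "('k::field \<Rightarrow> real) \<Rightarrow> bool" where
  "is_complex_field nrm \<longleftrightarrow> (\<exists>\<phi> :: 'k \<Rightarrow> complex. isometric_field_iso nrm \<phi>)"

definition field_cball :: "('k::field \<Rightarrow> real) \<Rightarrow> 'k \<Rightarrow> real \<Rightarrow> 'k set" where
  "field_cball nrm a r = {x. nrm (x - a) \<le> r}"

definition spherically_complete :: "('k::field \<Rightarrow> real) \<Rightarrow> bool" where
  "spherically_complete nrm \<longleftrightarrow>
     (\<forall>(a :: nat \<Rightarrow> 'k) r. (\<forall>n. 0 < r n) \<and>
        (\<forall>n. field_cball nrm (a (Suc n)) (r (Suc n)) \<subseteq> field_cball nrm (a n) (r n))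
        \<longrightarrow> (\<Inter>n. field_cball nrm (a n) (r n)) \<noteq> {})"

definition nonarch_sph_complete_field :: "('k::field \<Rightarrow> real) \<Rightarrow> bool" where
  "nonarch_sph_complete_field nrm \<longleftrightarrow>
     absolute_value nrm \<and> ultrametric_norm nrm \<and> (\<exists>x. x \<noteq> 0 \<and> nrm x \<noteq> 1) \<and>
     spherically_complete nrm"

definition field_topology :: "('k::field \<Rightarrow> real) \<Rightarrow> 'k topology" where
  "field_topology nrm = Metric_space.mtopology UNIV (\<lambda>x y. nrm (x - y))"


section \<open>Topological vector spaces\<close>

text \<open>
  The vector space underlying a topological vector space \<open>T\<close> is the subspace \<open>topspace T\<close> of
  the ambient type; this is needed for spaces of operators, which are not full types.
\<close>

definition topological_vector_space ::
    "('k::field \<Rightarrow> real) \<Rightarrow> ('k \<Rightarrow> 'a::ab_group_add \<Rightarrow> 'a) \<Rightarrow> 'a topology \<Rightarrow> bool" where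
  "topological_vector_space nrm sc T \<longleftrightarrow>
     vector_space sc \<and> module.subspace sc (topspace T) \<and>
     continuous_map (prod_topology T T) T (\<lambda>(x, y). x + y) \<and>
     continuous_map (prod_topology (field_topology nrm) T) T (\<lambda>(l, x). sc l x)"

definition zero_nhd :: "'a::ab_group_add topology \<Rightarrow> 'a set \<Rightarrow> bool" where
  "zero_nhd T U \<longleftrightarrow> U \<subseteq> topspace T \<and> (\<exists>G. openin T G \<and> 0 \<in> G \<and> G \<subseteq> U)"

definition zero_nhd_base :: "'a::ab_group_add topology \<Rightarrow> 'a set set \<Rightarrow> bool" where
  "zero_nhd_base T \<V> \<longleftrightarrow>
     (\<forall>U\<in>\<V>. zero_nhd T U) \<and> (\<forall>G. zero_nhd T G \<longrightarrow> (\<exists>U\<in>\<V>. U \<subseteq> G))"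

text \<open>The (unique) isometric copy of the reals inside a real or complex field; it supplies the
  real coefficients in the definition of convexity.\<close>

definition real_scalars :: "('k::field \<Rightarrow> real) \<Rightarrow> (real \<Rightarrow> 'k) \<Rightarrow> bool" where
  "real_scalars nrm \<iota> \<longleftrightarrow>
     (\<forall>s t. \<iota> (s + t) = \<iota> s + \<iota> t) \<and> (\<forall>s t. \<iota> (s * t) = \<iota> s * \<iota> t) \<and>
     (\<forall>t. nrm (\<iota> t) = \<bar>t\<bar>)"

definition convex_over ::
    "('k::field \<Rightarrow> real) \<Rightarrow> ('k \<Rightarrow> 'a::ab_group_add \<Rightarrow> 'a) \<Rightarrow> 'a set \<Rightarrow> bool" where
  "convex_over nrm sc A \<longleftrightarrow>
     (\<exists>\<iota>. real_scalars nrm \<iota> \<and>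
        (\<forall>x\<in>A. \<forall>y\<in>A. \<forall>t\<in>{0..1}. sc (\<iota> (1 - t)) x + sc (\<iota> t) y \<in> A))"

text \<open>Non-Archimedean analogue: stability under combinations with coefficients in the unit ball.\<close>

definition nonarch_abs_convex ::
    "('k::field \<Rightarrow> real) \<Rightarrow> ('k \<Rightarrow> 'a::ab_group_add \<Rightarrow> 'a) \<Rightarrow> 'a set \<Rightarrow> bool" where
  "nonarch_abs_convex nrm sc A \<longleftrightarrow>
     (\<forall>x\<in>A. \<forall>y\<in>A. \<forall>a b. nrm a \<le> 1 \<and> nrm b \<le> 1 \<longrightarrow> sc a x + sc b y \<in> A)"

definition locally_convex_space ::
    "('k::field \<Rightarrow> real) \<Rightarrow> ('k \<Rightarrow> 'a::ab_group_add \<Rightarrow> 'a) \<Rightarrow> 'a topology \<Rightarrow> bool" where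
  "locally_convex_space nrm sc T \<longleftrightarrow>
     topological_vector_space nrm sc T \<and>
     (if ultrametric_norm nrm
      then neighbourhood_base_at 0 (nonarch_abs_convex nrm sc) T
      else neighbourhood_base_at 0 (convex_over nrm sc) T)"


section \<open>$\kappa$-norms\<close>

text \<open>The family of closed \<open>G\<^sub>\<delta>\<close>-subsets; the empty set is a member.\<close>

definition closed_gdeltas :: "'a topology \<Rightarrow> 'a set set" where
  "closed_gdeltas X = {C. closedin X C \<and> gdelta_in X C}"

text \<open>The sum is replaced by the maximum in the non-Archimedean case.\<close>

definition kplus :: "('k::field \<Rightarrow> real) \<Rightarrow> ennreal \<Rightarrow> ennreal \<Rightarrow> ennreal" where
  "kplus nrm a b = (if ultrametric_norm nrm then max a b else a + b)"

text \<open>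
  \<open>kappa_norm_on nrm sc T L \<rho>\<close>: \<open>\<rho>\<close> is a $\kappa$-norm on \<open>L\<close> and the closed
  \<open>G\<^sub>\<delta>\<close>-subsets of \<open>L\<close>, where \<open>L\<close> is a subset of the topological vector space \<open>T\<close> and carries
  the induced topology and uniformity. An axiom is required whenever the results of the
  operations occurring in it lie in \<open>L\<close>, respectively in the family of closed \<open>G\<^sub>\<delta>\<close>-subsets.

  The range of an increasing transfinite sequence of sets is a family well-ordered by
  inclusion, and every such family is the range of one; the closure of the union and the infimum
  depend only on the range.

  Uniform continuity is written without subtraction since \<open>\<rho>\<close> is constantly infinite on the
  empty set.
\<close>

definition kappa_norm_on ::
    "('k::field \<Rightarrow> real) \<Rightarrow> ('k \<Rightarrow> 'a::ab_group_add \<Rightarrow> 'a) \<Rightarrow> 'a topology \<Rightarrow> 'a set \<Rightarrow>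
     ('a \<Rightarrow> 'a set \<Rightarrow> ennreal) \<Rightarrow> bool" where
  "kappa_norm_on nrm sc T L \<rho> \<longleftrightarrow>
    (let S = closed_gdeltas (subtopology T L);
         cl = (\<lambda>A. subtopology T L closure_of A)
     in
      (\<forall>x\<in>L. \<forall>C\<in>S. \<rho> x C = 0 \<longleftrightarrow> x \<in> C) \<and>
      (\<forall>x\<in>L. \<forall>C\<in>S. \<forall>C'\<in>S. C \<subseteq> C' \<longrightarrow> \<rho> x C' \<le> \<rho> x C) \<and>
      (\<forall>C\<in>S. \<forall>e::real. 0 < e \<longrightarrow>
         (\<exists>U. zero_nhd T U \<and>
            (\<forall>x\<in>L. \<forall>y\<in>L. x - y \<in> U \<longrightarrow>
               \<rho> x C \<le> \<rho> y C + ennreal e \<and> \<rho> y C \<le> \<rho> x C + ennreal e))) \<and>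
      (\<forall>F. F \<noteq> {} \<and> F \<subseteq> S \<and> (\<forall>G. G \<subseteq> F \<and> G \<noteq> {} \<longrightarrow> (\<exists>C\<in>G. \<forall>D\<in>G. C \<subseteq> D)) \<and>
         cl (\<Union>F) \<in> S \<longrightarrow>
         (\<forall>x\<in>L. \<rho> x (cl (\<Union>F)) = (INF C\<in>F. \<rho> x C))) \<and>
      (\<forall>x\<in>L. \<forall>y\<in>L. \<forall>C1\<in>S. \<forall>C2\<in>S.
         x + y \<in> L \<and> {a + b |a b. a \<in> C1 \<and> b \<in> C2} \<subseteq> L \<and>
         cl {a + b |a b. a \<in> C1 \<and> b \<in> C2} \<in> S \<longrightarrow>
         \<rho> (x + y) (cl {a + b |a b. a \<in> C1 \<and> b \<in> C2}) \<le> kplus nrm (\<rho> x C1) (\<rho> y C2)) \<and>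
      (\<forall>x\<in>L. \<forall>C1\<in>S. \<forall>C2\<in>S. \<rho> x C1 \<le> kplus nrm (\<rho> x C2) (SUP z\<in>C2. \<rho> z C1)) \<and>
      (\<forall>x\<in>L. \<forall>C\<in>S. \<forall>l. l \<noteq> 0 \<and> sc l x \<in> L \<and> sc l ` C \<in> S \<longrightarrow>
         \<rho> (sc l x) (sc l ` C) = ennreal (nrm l) * \<rho> x C) \<and>
      (\<forall>x\<in>L. \<forall>y\<in>L. \<forall>C\<in>S. x + y \<in> L \<and> (+) y ` C \<in> S \<longrightarrow>
         \<rho> (x + y) ((+) y ` C) = \<rho> x C) \<and>
      (\<forall>x\<in>L. \<rho> x {} = \<infinity>) \<and> (\<forall>x\<in>L. \<forall>C\<in>S. C \<noteq> {} \<longrightarrow> \<rho> x C < \<infinity>))"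

definition kappa_normable ::
    "('k::field \<Rightarrow> real) \<Rightarrow> ('k \<Rightarrow> 'a::ab_group_add \<Rightarrow> 'a) \<Rightarrow> 'a topology \<Rightarrow> bool" where
  "kappa_normable nrm sc T \<longleftrightarrow> (\<exists>\<rho>. kappa_norm_on nrm sc T (topspace T) \<rho>)"

definition conditionally_kappa_normable ::
    "('k::field \<Rightarrow> real) \<Rightarrow> ('k \<Rightarrow> 'a::ab_group_add \<Rightarrow> 'a) \<Rightarrow> 'a topology \<Rightarrow> 'a set \<Rightarrow> bool" where
  "conditionally_kappa_normable nrm sc T L \<longleftrightarrow> (\<exists>\<rho>. kappa_norm_on nrm sc T L \<rho>)"


section \<open>Spaces of operators\<close>

text \<open>Operators are added pointwise (instances from \<^theory>\<open>HOL-Library.Function_Algebras\<close>).\<close>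

definition op_scale :: "('k \<Rightarrow> 'x \<Rightarrow> 'x) \<Rightarrow> 'k \<Rightarrow> ('x \<Rightarrow> 'x) \<Rightarrow> 'x \<Rightarrow> 'x" where
  "op_scale sc l A = (\<lambda>x. sc l (A x))"

definition cont_operators ::
    "('k::field \<Rightarrow> 'x::ab_group_add \<Rightarrow> 'x) \<Rightarrow> 'x topology \<Rightarrow> ('x \<Rightarrow> 'x) set" where
  "cont_operators sc T = {A. Vector_Spaces.linear sc sc A \<and> continuous_map T T A}"

definition linear_homeos ::
    "('k::field \<Rightarrow> 'x::ab_group_add \<Rightarrow> 'x) \<Rightarrow> 'x topology \<Rightarrow> ('x \<Rightarrow> 'x) set" where
  "linear_homeos sc T = {A. Vector_Spaces.linear sc sc A \<and> homeomorphic_map T T A}"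

definition op_nhd ::
    "('k::field \<Rightarrow> 'x::ab_group_add \<Rightarrow> 'x) \<Rightarrow> 'x topology \<Rightarrow> 'x set \<Rightarrow> 'x set \<Rightarrow> ('x \<Rightarrow> 'x) set" where
  "op_nhd sc T U V = {A \<in> cont_operators sc T. A ` U \<subseteq> V}"

text \<open>
  \<open>TO\<close> is the topology of the vector space of continuous operators for which the sets
  \<open>op_nhd U V\<close>, with \<open>U\<close> and \<open>V\<close> in a base \<open>\<V>\<close> of neighbourhoods of zero, form a base at zero.
  At most one vector topology has a given base at zero. That \<open>TO\<close> is a vector topology
  restricts \<open>\<V>\<close>: if \<open>\<V>\<close> is a base of the real line that contains the whole line, then
  \<open>op_nhd UNIV V\<close> is \<open>{0}\<close> for bounded \<open>V\<close>, and scalar multiplication of operators is not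
  continuous in the resulting discrete topology.
\<close>

definition operator_topology ::
    "('k::field \<Rightarrow> real) \<Rightarrow> ('k \<Rightarrow> 'x::ab_group_add \<Rightarrow> 'x) \<Rightarrow> 'x topology \<Rightarrow> 'x set set \<Rightarrow>
     ('x \<Rightarrow> 'x) topology \<Rightarrow> bool" where
  "operator_topology nrm sc T \<V> TO \<longleftrightarrow>
     zero_nhd_base T \<V> \<and>
     topspace TO = cont_operators sc T \<and>
     topological_vector_space nrm (op_scale sc) TO \<and>
     zero_nhd_base TO {op_nhd sc T U V |U V. U \<in> \<V> \<and> V \<in> \<V>}"

end

theory Submission
  imports Defs
begin

text \<open>
  The theorem holds because a \<open>\<kappa>\<close>-norm for all closed \<open>G\<^sub>\<delta>\<close> sets forces the topology of \<open>X\<close> to be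
  given by a single seminorm. The distance to a closed \<open>G\<^sub>\<delta>\<close> subspace \<open>N\<close> is a continuous seminorm
  with kernel \<open>N\<close>, and these seminorms grow as \<open>N\<close> shrinks. If \<open>C\<close> is a closed \<open>G\<^sub>\<delta>\<close> set that
  does not contain zero and is invariant under \<open>N\<close>, then the triangle inequality (N5a) for
  \<open>C + N = C\<close> shows that the seminorm with kernel \<open>N\<close> is bounded away from zero on \<open>C\<close>. Every
  neighbourhood of zero contains the complement of such a set \<open>C\<close>, for a suitable \<open>N\<close>
  (\<open>gdelta_subspace_in_nhd\<close>). So once there is a least closed \<open>G\<^sub>\<delta>\<close> subspace, its seminorm
  generates the topology (\<open>topology_seminormable\<close>).

  The least subspace comes from the continuity axiom (N4)
  (\<open>chain_gdelta_subspace_bounded_below\<close>). If a chain of closed \<open>G\<^sub>\<delta>\<close> subspaces had no lower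
  bound, the sets where the corresponding seminorms are at least 1 would form an increasing family
  with dense union, so their \<open>\<rho>\<close>-distances from zero would have infimum zero. Since countable
  intersections of closed \<open>G\<^sub>\<delta>\<close> subspaces are again of this kind, a chain without lower bound
  has no countable coinitial part; the infimum would be attained, and zero would lie in one of the
  sets.

  For a seminormed space the rest is classical. Continuous operators are the bounded ones, the balls
  form a base for which the operator seminorm defines the required vector topology, and every
  admissible base leads to the same topology, since the members of an admissible base are
  bounded (\<open>operator_topology_unique\<close>). Finally, the distance to a set in the operator seminorm is a
  conditional \<open>\<kappa>\<close>-norm on any set of operators (\<open>kappa_norm_on_seminorm_dist\<close>), in
  particular on the linear homeomorphisms.
\<close>

section \<open>Valued fields\<close>

text \<open>The operation \<open>kplus\<close> for real numbers: it states the triangle inequality of seminorms, the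
  ultrametric case included, without leaving the reals.\<close>

definition real_kplus :: "('k::field \<Rightarrow> real) \<Rightarrow> real \<Rightarrow> real \<Rightarrow> real" where
  "real_kplus nrm a b = (if ultrametric_norm nrm then max a b else a + b)"

lemma ennreal_real_kplus:
  "0 \<le> a \<Longrightarrow> 0 \<le> b \<Longrightarrow> ennreal (real_kplus nrm a b) = kplus nrm (ennreal a) (ennreal b)"
  by (auto simp: real_kplus_def kplus_def max_def ennreal_le_iff)

lemma real_kplus_le_add: "0 \<le> a \<Longrightarrow> 0 \<le> b \<Longrightarrow> real_kplus nrm a b \<le> a + b"
  by (simp add: real_kplus_def)

lemma real_kplus_nonneg: "0 \<le> a \<Longrightarrow> 0 \<le> b \<Longrightarrow> 0 \<le> real_kplus nrm a b"
  by (simp add: real_kplus_def le_max_iff_disj)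

lemma real_kplus_mono: "a \<le> a' \<Longrightarrow> b \<le> b' \<Longrightarrow> real_kplus nrm a b \<le> real_kplus nrm a' b'"
  by (auto simp: real_kplus_def)

lemma real_kplus_mult_right:
  "0 \<le> c \<Longrightarrow> real_kplus nrm a b * c = real_kplus nrm (a * c) (b * c)"
  by (simp add: real_kplus_def max_mult_distrib_right distrib_right)

lemma kplus_mono: "a \<le> a' \<Longrightarrow> b \<le> b' \<Longrightarrow> kplus nrm a b \<le> kplus nrm a' b'"
  by (auto simp: kplus_def le_max_iff_disj intro: add_mono)

lemma kplus_commute: "kplus nrm a b = kplus nrm b a"
  by (simp add: kplus_def max.commute add.commute)

lemma kplus_zero_left: "kplus nrm 0 b = b"
  by (simp add: kplus_def)

text \<open>An inequality against \<open>kplus\<close> passes to the infimum in one argument. This reduces every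
  triangle inequality for distances to sets to single points of the sets; an empty set
  contributes the value infinity and makes the bound trivial.\<close>

lemma le_kplus_INF:
  assumes "\<And>z. z \<in> C \<Longrightarrow> a \<le> kplus nrm (f z) c"
  shows "a \<le> kplus nrm (INF z\<in>C. f z) c"
proof (cases "ultrametric_norm nrm")
  case True
  show ?thesis
  proof (cases "a \<le> c")
    case False
    then have "a \<le> (INF z\<in>C. f z)"
      using assms True by (intro INF_greatest) (fastforce simp: kplus_def le_max_iff_disj)
    then show ?thesis using True by (simp add: kplus_def le_max_iff_disj)
  qed (simp add: True kplus_def le_max_iff_disj)
next
  case False
  show ?thesis
  proof (cases "c = top")
    case c: False
    have "a - c \<le> (INF z\<in>C. f z)"
    proof (rule INF_greatest)
      fix z assume "z \<in> C"
      then have "a \<le> c + f z" using assms[of z] False by (simp add: kplus_def add.commute)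
      then show "a - c \<le> f z" using c by (simp add: ennreal_minus_le_iff)
    qed
    then have "a \<le> c + (INF z\<in>C. f z)"
      using c by (simp add: ennreal_minus_le_iff)
    then show ?thesis using False by (simp add: kplus_def add.commute)
  qed (simp add: False kplus_def)
qed

locale valued_field =
  fixes nrm :: "'k::field \<Rightarrow> real"
  assumes absolute_value: "absolute_value nrm"
    and nontrivial: "\<exists>l. l \<noteq> 0 \<and> nrm l < 1"
begin

lemma nrm_nonneg: "0 \<le> nrm l"
  and nrm_eq_0: "nrm l = 0 \<longleftrightarrow> l = 0"
  and nrm_mult: "nrm (l * m) = nrm l * nrm m"
  and nrm_add: "nrm (l + m) \<le> nrm l + nrm m"
  using absolute_value by (auto simp: absolute_value_def)

lemma nrm_pos: "l \<noteq> 0 \<Longrightarrow> 0 < nrm l"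
  using nrm_nonneg[of l] nrm_eq_0[of l] by linarith

lemma nrm_0: "nrm 0 = 0"
  by (simp add: nrm_eq_0)

lemma nrm_1: "nrm 1 = 1"
  using nrm_mult[of 1 1] nrm_eq_0[of 1] by simp

lemma nrm_inverse: "l \<noteq> 0 \<Longrightarrow> nrm (inverse l) = inverse (nrm l)"
  using nrm_mult[of l "inverse l"] nrm_1 by (simp add: field_simps nrm_eq_0)

lemma nrm_power: "nrm (l ^ n) = nrm l ^ n"
  by (induction n) (simp_all add: nrm_1 nrm_mult)

lemma nrm_minus_1: "nrm (- 1) = 1"
proof -
  have "(nrm (- 1))\<^sup>2 = 1"
    using nrm_mult[of "- 1" "- 1"] nrm_1 by (simp add: power2_eq_square)
  then show ?thesis using nrm_nonneg[of "- 1"] by (simp add: power2_eq_1_iff)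
qed

lemma nrm_minus: "nrm (- l) = nrm l"
  using nrm_mult[of "- 1" l] nrm_minus_1 by simp

lemma Metric_space_nrm: "Metric_space UNIV (\<lambda>l m. nrm (l - m))"
proof
  fix l m k
  show "nrm (l - m) = nrm (m - l)" using nrm_minus[of "l - m"] by simp
  show "nrm (l - k) \<le> nrm (l - m) + nrm (m - k)" using nrm_add[of "l - m" "m - k"] by simp
qed (simp_all add: nrm_nonneg nrm_eq_0)

lemma openin_field_topology:
  "openin (field_topology nrm) U \<longleftrightarrow> (\<forall>l\<in>U. \<exists>d>0. \<forall>m. nrm (m - l) < d \<longrightarrow> m \<in> U)"
proof -
  interpret Metric_space UNIV "\<lambda>l m. nrm (l - m)" by (rule Metric_space_nrm)
  have "mball l d = {m. nrm (m - l) < d}" for l d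
    using commute by (auto simp: mball_def)
  then show ?thesis
    by (auto simp: field_topology_def openin_mtopology subset_eq)
qed

lemma openin_field_ball: "openin (field_topology nrm) {m. nrm (m - l) < d}"
  unfolding openin_field_topology
proof
  fix m assume m: "m \<in> {m. nrm (m - l) < d}"
  have "nrm (k - l) < d" if "nrm (k - m) < d - nrm (m - l)" for k
    using that nrm_add[of "k - m" "m - l"] by simp
  then show "\<exists>e>0. \<forall>k. nrm (k - m) < e \<longrightarrow> k \<in> {m. nrm (m - l) < d}"
    using m by (intro exI[of _ "d - nrm (m - l)"]) auto
qed

text \<open>Multiplication by powers of one scalar of norm strictly between 0 and 1 moves any \<open>t > 0\<close> into
  the interval from \<open>c * r\<close> to \<open>r\<close>, where \<open>c\<close> is the norm of that scalar. Over a field whose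
  norm takes only discrete values this replaces exact rescaling to length \<open>r\<close>.\<close>

lemma scalar_between:
  assumes "0 < r"
  shows "\<exists>c>0. \<forall>t>0. \<exists>l. l \<noteq> 0 \<and> c * r \<le> nrm l * t \<and> nrm l * t < r"
proof -
  obtain m where m: "m \<noteq> 0" "nrm m < 1" using nontrivial by blast
  define a where "a = nrm m"
  have a: "0 < a" "a < 1" using m nrm_pos by (auto simp: a_def)
  have "\<exists>l. l \<noteq> 0 \<and> a * r \<le> nrm l * t \<and> nrm l * t < r" if t: "0 < t" for t
  proof -
    \<comment> \<open>A number that is at least \<open>r\<close> is shrunk until it first drops below \<open>r\<close>; the last factor was \<open>a\<close>.\<close>
    have *: "\<exists>l. l \<noteq> 0 \<and> a * r \<le> nrm l * s \<and> nrm l * s < r" if s: "r \<le> s" for s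
    proof -
      obtain n where n: "a ^ n < r / s"
        using real_arch_pow_inv[of "r / s" a] a assms s by auto
      then have ex: "\<exists>n. a ^ n * s < r" using s assms by (auto simp: field_simps)
      define k where "k = (LEAST n. a ^ n * s < r)"
      have k: "a ^ k * s < r" unfolding k_def using ex by (rule LeastI_ex)
      then have "k \<noteq> 0" using s by (intro notI) simp
      then obtain j where j: "k = Suc j" by (cases k) auto
      have "\<not> a ^ j * s < r"
        using not_less_Least[of j "\<lambda>n. a ^ n * s < r"] by (simp add: k_def[symmetric] j)
      then have "a * r \<le> a * (a ^ j * s)" using a by simp
      then show ?thesis
        using k m by (intro exI[of _ "m ^ k"]) (simp add: nrm_power nrm_mult a_def j mult.assoc)
    qed
    \<comment> \<open>A small \<open>t\<close> is first made large.\<close>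
    obtain n where n: "inverse a ^ n > r / t"
      using real_arch_pow[of "inverse a" "r / t"] a by (auto simp: one_less_inverse_iff)
    moreover have "nrm (inverse m ^ n) = inverse a ^ n"
      using m by (simp only: nrm_power nrm_inverse a_def not_False_eq_True)
    ultimately have "r \<le> nrm (inverse m ^ n) * t"
      using t by (simp only: pos_divide_less_eq less_imp_le)
    from *[OF this] obtain l where "l \<noteq> 0" "a * r \<le> nrm l * (nrm (inverse m ^ n) * t)"
      "nrm l * (nrm (inverse m ^ n) * t) < r" by blast
    then show ?thesis
      using m by (intro exI[of _ "l * inverse m ^ n"]) (simp add: nrm_mult mult.assoc)
  qed
  then show ?thesis using a by (intro exI[of _ a]) auto
qed

lemma small_scalar: "0 < e \<Longrightarrow> \<exists>l. l \<noteq> 0 \<and> nrm l < e"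
  using scalar_between[of e] by (metis mult.right_neutral zero_less_one)

lemma large_scalar: "\<exists>l. l \<noteq> 0 \<and> e \<le> nrm l"
proof -
  obtain l where l: "l \<noteq> 0" "nrm l < inverse (max e 1)"
    using small_scalar[of "inverse (max e 1)"] by (metis inverse_positive_iff_positive less_max_iff_disj zero_less_one)
  then have "max e 1 \<le> nrm (inverse l)"
    using less_imp_inverse_less[OF l(2) nrm_pos[OF l(1)]] by (simp add: nrm_inverse l(1))
  then show ?thesis using l by (intro exI[of _ "inverse l"]) auto
qed

end

section \<open>Topologies given by a seminorm\<close>

definition seminorm_topology :: "'a::ab_group_add set \<Rightarrow> ('a \<Rightarrow> real) \<Rightarrow> 'a topology" where
  "seminorm_topology V p =
     topology (\<lambda>G. G \<subseteq> V \<and> (\<forall>x\<in>G. \<exists>e>0. \<forall>y\<in>V. p (y - x) < e \<longrightarrow> y \<in> G))"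

lemma openin_seminorm_topology:
  "openin (seminorm_topology V p) G \<longleftrightarrow>
     G \<subseteq> V \<and> (\<forall>x\<in>G. \<exists>e>0. \<forall>y\<in>V. p (y - x) < e \<longrightarrow> y \<in> G)"
proof -
  let ?O = "\<lambda>G. G \<subseteq> V \<and> (\<forall>x\<in>G. \<exists>e>0. \<forall>y\<in>V. p (y - x) < e \<longrightarrow> y \<in> G)"
  have "?O (G \<inter> H)" if G: "?O G" and H: "?O H" for G H
  proof (intro conjI ballI)
    fix x assume x: "x \<in> G \<inter> H"
    obtain d where d: "0 < d" "\<forall>y\<in>V. p (y - x) < d \<longrightarrow> y \<in> G" using G x by blast
    obtain e where e: "0 < e" "\<forall>y\<in>V. p (y - x) < e \<longrightarrow> y \<in> H" using H x by blast
    show "\<exists>e>0. \<forall>y\<in>V. p (y - x) < e \<longrightarrow> y \<in> G \<inter> H"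
      using d e by (intro exI[of _ "min d e"]) auto
  qed (use G in auto)
  moreover have "?O (\<Union>\<G>)" if "\<forall>G\<in>\<G>. ?O G" for \<G>
  proof (intro conjI ballI)
    fix x assume "x \<in> \<Union>\<G>"
    then obtain G where "G \<in> \<G>" "x \<in> G" by blast
    then show "\<exists>e>0. \<forall>y\<in>V. p (y - x) < e \<longrightarrow> y \<in> \<Union>\<G>"
      using that by (meson UnionI)
  qed (use that in auto)
  ultimately have "istopology ?O" by (simp add: istopology_def)
  then show ?thesis by (simp add: seminorm_topology_def)
qed

lemma topspace_seminorm_topology: "topspace (seminorm_topology V p) = V"
proof
  have "openin (seminorm_topology V p) V"
    by (auto simp: openin_seminorm_topology intro: exI[of _ "1::real"])
  then show "V \<subseteq> topspace (seminorm_topology V p)" by (rule openin_subset)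
  show "topspace (seminorm_topology V p) \<subseteq> V"
    using openin_topspace[of "seminorm_topology V p"] by (simp only: openin_seminorm_topology)
qed

locale seminormed_space = valued_field nrm + vector_space sc
  for nrm :: "'k::field \<Rightarrow> real" and sc :: "'k \<Rightarrow> 'a::ab_group_add \<Rightarrow> 'a" +
  fixes V :: "'a set" and p :: "'a \<Rightarrow> real"
  assumes V: "subspace V"
    and p_nonneg: "x \<in> V \<Longrightarrow> 0 \<le> p x"
    and p_scale: "x \<in> V \<Longrightarrow> p (sc l x) = nrm l * p x"
    and p_add_kplus: "x \<in> V \<Longrightarrow> y \<in> V \<Longrightarrow> p (x + y) \<le> real_kplus nrm (p x) (p y)"
begin

lemma p_add: "x \<in> V \<Longrightarrow> y \<in> V \<Longrightarrow> p (x + y) \<le> p x + p y"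
  using p_add_kplus[of x y] real_kplus_le_add[of "p x" "p y" nrm] p_nonneg by fastforce

lemma p_0: "p 0 = 0"
  using p_scale[of 0 0] subspace_0[OF V] by (simp add: nrm_0)

lemma p_minus: "x \<in> V \<Longrightarrow> p (- x) = p x"
  using p_scale[of x "- 1"] by (simp add: nrm_minus_1)

lemma p_diff_commute: "x \<in> V \<Longrightarrow> y \<in> V \<Longrightarrow> p (x - y) = p (y - x)"
  using p_minus[of "x - y"] subspace_diff[OF V] by simp

lemma p_diff_triangle: "x \<in> V \<Longrightarrow> y \<in> V \<Longrightarrow> z \<in> V \<Longrightarrow> p (x - z) \<le> p (x - y) + p (y - z)"
  using p_add[of "x - y" "y - z"] subspace_diff[OF V] by simp

abbreviation "Tp \<equiv> seminorm_topology V p"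

lemma openin_ball:
  assumes x: "x \<in> V"
  shows "openin Tp {y \<in> V. p (y - x) < e}"
  unfolding openin_seminorm_topology
proof (intro conjI ballI)
  fix y assume y: "y \<in> {y \<in> V. p (y - x) < e}"
  have "p (z - x) < e" if "z \<in> V" "p (z - y) < e - p (y - x)" for z
    using p_diff_triangle[of z y x] that x y by simp
  then show "\<exists>d>0. \<forall>z\<in>V. p (z - y) < d \<longrightarrow> z \<in> {y \<in> V. p (y - x) < e}"
    using y by (intro exI[of _ "e - p (y - x)"]) auto
qed auto

lemma zero_nhd_seminorm_topology:
  "zero_nhd Tp W \<longleftrightarrow> W \<subseteq> V \<and> (\<exists>e>0. {x \<in> V. p x < e} \<subseteq> W)"
proof
  assume W: "zero_nhd Tp W"
  then obtain G where G: "openin Tp G" "0 \<in> G" "G \<subseteq> W" "W \<subseteq> V"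
    by (auto simp: zero_nhd_def topspace_seminorm_topology)
  then obtain e where "e > 0" "\<forall>y\<in>V. p (y - 0) < e \<longrightarrow> y \<in> G"
    unfolding openin_seminorm_topology by blast
  then show "W \<subseteq> V \<and> (\<exists>e>0. {x \<in> V. p x < e} \<subseteq> W)" using G by auto
next
  assume "W \<subseteq> V \<and> (\<exists>e>0. {x \<in> V. p x < e} \<subseteq> W)"
  then obtain e where e: "W \<subseteq> V" "e > 0" "{x \<in> V. p x < e} \<subseteq> W" by blast
  have "openin Tp {x \<in> V. p x < e}" using openin_ball[OF subspace_0[OF V], of e] by simp
  moreover have "0 \<in> {x \<in> V. p x < e}" using e subspace_0[OF V] by (simp add: p_0)
  ultimately show "zero_nhd Tp W"
    using e by (auto simp: zero_nhd_def topspace_seminorm_topology)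
qed

lemma continuous_map_add: "continuous_map (prod_topology Tp Tp) Tp (\<lambda>(x, y). x + y)"
  unfolding continuous_map_def
proof (intro conjI allI impI)
  show "(\<lambda>(x, y). x + y) \<in> topspace (prod_topology Tp Tp) \<rightarrow> topspace Tp"
    by (auto simp: topspace_seminorm_topology intro: subspace_add[OF V])
  fix G assume G: "openin Tp G"
  let ?S = "{z \<in> topspace (prod_topology Tp Tp). (case z of (x, y) \<Rightarrow> x + y) \<in> G}"
  show "openin (prod_topology Tp Tp) ?S"
    unfolding openin_prod_topology_alt
  proof (intro allI impI)
    fix x y assume "(x, y) \<in> ?S"
    then have xy: "x \<in> V" "y \<in> V" "x + y \<in> G" by (auto simp: topspace_seminorm_topology)
    then obtain e where e: "e > 0" "\<forall>z\<in>V. p (z - (x + y)) < e \<longrightarrow> z \<in> G"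
      using G unfolding openin_seminorm_topology by blast
    let ?B = "\<lambda>x. {z \<in> V. p (z - x) < e / 2}"
    have "x' + y' \<in> G" if "x' \<in> ?B x" "y' \<in> ?B y" for x' y'
    proof -
      have eq: "x' + y' - (x + y) = (x' - x) + (y' - y)" by simp
      have "p (x' + y' - (x + y)) \<le> p (x' - x) + p (y' - y)"
        unfolding eq using that xy subspace_diff[OF V] by (intro p_add) auto
      then show ?thesis using e that subspace_add[OF V] by auto
    qed
    then have "?B x \<times> ?B y \<subseteq> ?S" by (auto simp: topspace_seminorm_topology)
    moreover have "x \<in> ?B x" "y \<in> ?B y" using xy e by (auto simp: p_0)
    ultimately show "\<exists>U U'. openin Tp U \<and> openin Tp U' \<and> x \<in> U \<and> y \<in> U' \<and> U \<times> U' \<subseteq> ?S"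
      using xy by (intro exI[of _ "?B x"] exI[of _ "?B y"] conjI openin_ball)
  qed
qed

lemma continuous_map_scale:
  "continuous_map (prod_topology (field_topology nrm) Tp) Tp (\<lambda>(l, x). sc l x)"
  unfolding continuous_map_def
proof (intro conjI allI impI)
  let ?P = "prod_topology (field_topology nrm) Tp"
  have top: "topspace ?P = UNIV \<times> V"
    using Metric_space.topspace_mtopology[OF Metric_space_nrm]
    by (simp add: topspace_seminorm_topology field_topology_def)
  show "(\<lambda>(l, x). sc l x) \<in> topspace ?P \<rightarrow> topspace Tp"
    by (auto simp: top topspace_seminorm_topology intro: subspace_scale[OF V])
  fix G assume G: "openin Tp G"
  let ?S = "{z \<in> topspace ?P. (case z of (l, x) \<Rightarrow> sc l x) \<in> G}"
  show "openin ?P ?S"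
    unfolding openin_prod_topology_alt
  proof (intro allI impI)
    fix l x assume "(l, x) \<in> ?S"
    then have x: "x \<in> V" "sc l x \<in> G" using top by auto
    then obtain e where e: "e > 0" "\<forall>z\<in>V. p (z - sc l x) < e \<longrightarrow> z \<in> G"
      using G unfolding openin_seminorm_topology by blast
    define d where "d = min 1 (e / (2 * (p x + 1)))"
    define h where "h = e / (2 * (nrm l + 1))"
    have px: "0 \<le> p x" and nl: "0 \<le> nrm l" using x p_nonneg nrm_nonneg by auto
    have d: "0 < d" "d \<le> 1" "d * p x < e / 2"
    proof -
      have "d * p x \<le> e / (2 * (p x + 1)) * p x" using px by (intro mult_right_mono) (auto simp: d_def)
      also have "\<dots> < e / 2" using px e by (simp add: field_simps)
      finally show "d * p x < e / 2" .
    qed (use px e in \<open>auto simp: d_def\<close>)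
    have h: "0 < h" "(nrm l + 1) * h = e / 2" using nl e by (auto simp: h_def field_simps)
    let ?L = "{m. nrm (m - l) < d}" and ?B = "{z \<in> V. p (z - x) < h}"
    have "sc m z \<in> G" if m: "m \<in> ?L" and z: "z \<in> ?B" for m z
    proof -
      have zx: "z - x \<in> V" using z x subspace_diff[OF V] by simp
      have "sc m z - sc l x = sc m (z - x) + sc (m - l) x"
        by (simp add: scale_right_diff_distrib scale_left_diff_distrib)
      then have "p (sc m z - sc l x) \<le> nrm m * p (z - x) + nrm (m - l) * p x"
        using p_add[of "sc m (z - x)" "sc (m - l) x"] zx x subspace_scale[OF V] p_scale by simp
      moreover have "nrm m \<le> nrm l + 1"
        using nrm_add[of "m - l" l] m d by simp
      then have "nrm m * p (z - x) \<le> (nrm l + 1) * h"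
        using z nl p_nonneg[OF zx] by (intro mult_mono) auto
      moreover have "nrm (m - l) * p x \<le> d * p x"
        using m px by (intro mult_right_mono) auto
      ultimately have "p (sc m z - sc l x) < e" using h d by linarith
      then show ?thesis using e z subspace_scale[OF V] by auto
    qed
    then have "?L \<times> ?B \<subseteq> ?S" unfolding top by auto
    moreover have "l \<in> ?L" "x \<in> ?B" using x d h by (auto simp: p_0 nrm_0)
    ultimately show "\<exists>U U'. openin (field_topology nrm) U \<and> openin Tp U' \<and> l \<in> U \<and> x \<in> U' \<and> U \<times> U' \<subseteq> ?S"
      by (intro exI[of _ ?L] exI[of _ ?B] conjI openin_ball[OF x(1)] openin_field_ball)
  qed
qed

lemma topological_vector_space_seminorm_topology: "topological_vector_space nrm sc Tp"
  unfolding topological_vector_space_def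
  using continuous_map_add continuous_map_scale V vector_space_axioms
  by (simp add: topspace_seminorm_topology)

end

text \<open>Translations are continuous, so neighbourhoods of any point are governed by neighbourhoods
  of zero.\<close>

lemma openin_translate:
  assumes T: "topological_vector_space nrm sc T" and G: "openin T G" and a: "a \<in> topspace T"
  shows "openin T {y \<in> topspace T. a + y \<in> G}"
proof -
  have "continuous_map T (prod_topology T T) (\<lambda>y. (a, y))"
    using a by (simp add: continuous_map_pairedI)
  then have "continuous_map T T ((\<lambda>(x, y). x + y) \<circ> (\<lambda>y. (a, y)))"
    using T unfolding topological_vector_space_def by (blast intro: continuous_map_compose)
  then show ?thesis using openin_continuous_map_preimage[OF _ G] by (simp add: o_def)
qed

text \<open>A vector topology is determined by its neighbourhoods of zero; this identifies an abstractly
  given topology with the one of a seminorm.\<close>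

lemma (in seminormed_space) eq_seminorm_topologyI:
  assumes T: "topological_vector_space nrm sc T" and top: "topspace T = V"
    and nhd: "\<And>W. zero_nhd T W \<longleftrightarrow> W \<subseteq> V \<and> (\<exists>e>0. {x \<in> V. p x < e} \<subseteq> W)"
  shows "T = Tp"
proof -
  have sub: "x \<in> V \<Longrightarrow> y \<in> V \<Longrightarrow> y - x \<in> V" for x y using subspace_diff[OF V] by blast
  have tp: "zero_nhd Tp W \<longleftrightarrow> zero_nhd T W" for W
    by (simp add: nhd zero_nhd_seminorm_topology)
  have main: "openin S G" if S: "topological_vector_space nrm sc S" "topspace S = V"
    and R: "topological_vector_space nrm sc R" "topspace R = V"
    and eq: "\<And>W. zero_nhd R W \<longleftrightarrow> zero_nhd S W" and G: "openin R G" for S R G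
  proof (subst openin_subopen, intro ballI)
    fix x assume x: "x \<in> G"
    then have xV: "x \<in> V" using openin_subset[OF G] R by auto
    have "zero_nhd R {y \<in> V. x + y \<in> G}"
      using openin_translate[OF R(1) G, of x] x xV R(2) subspace_0[OF V]
      by (auto simp: zero_nhd_def)
    then obtain H where H: "openin S H" "0 \<in> H" "H \<subseteq> {y \<in> V. x + y \<in> G}"
      unfolding eq by (auto simp: zero_nhd_def)
    have "openin S {y \<in> V. - x + y \<in> H}"
      using openin_translate[OF S(1) H(1), of "- x"] subspace_neg[OF V xV] S(2) by simp
    moreover have "{y \<in> V. - x + y \<in> H} \<subseteq> G" using H(3) by auto
    ultimately show "\<exists>H. openin S H \<and> x \<in> H \<and> H \<subseteq> G" using H(2) xV by force
  qed
  show ?thesis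
    unfolding topology_eq
    using main[OF T top topological_vector_space_seminorm_topology topspace_seminorm_topology]
      main[OF topological_vector_space_seminorm_topology topspace_seminorm_topology T top] tp
    by blast
qed

section \<open>The distance to a set as a $\kappa$-norm\<close>

context seminormed_space
begin

definition seminorm_dist :: "'a \<Rightarrow> 'a set \<Rightarrow> ennreal" where
  "seminorm_dist x C = (INF c\<in>C. ennreal (p (x - c)))"

lemma seminorm_dist_le: "c \<in> C \<Longrightarrow> seminorm_dist x C \<le> ennreal (p (x - c))"
  unfolding seminorm_dist_def by (rule INF_lower)

lemma seminorm_dist_antimono: "C \<subseteq> D \<Longrightarrow> seminorm_dist x D \<le> seminorm_dist x C"
  by (simp add: seminorm_dist_def INF_superset_mono)

lemma seminorm_dist_add:
  assumes "x \<in> V" "y \<in> V" "C \<subseteq> V" "D \<subseteq> V"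
  shows "seminorm_dist (x + y) {a + b |a b. a \<in> C \<and> b \<in> D} \<le> kplus nrm (seminorm_dist x C) (seminorm_dist y D)"
  unfolding seminorm_dist_def[of x]
proof (rule le_kplus_INF)
  fix a assume a: "a \<in> C"
  have "seminorm_dist (x + y) {a + b |a b. a \<in> C \<and> b \<in> D} \<le> kplus nrm (seminorm_dist y D) (ennreal (p (x - a)))"
    unfolding seminorm_dist_def[of y]
  proof (rule le_kplus_INF)
    fix b assume b: "b \<in> D"
    have V': "x - a \<in> V" "y - b \<in> V" using a b assms subspace_diff[OF V] by blast+
    have "seminorm_dist (x + y) {a + b |a b. a \<in> C \<and> b \<in> D} \<le> ennreal (p (x + y - (a + b)))"
      using a b by (intro seminorm_dist_le) blast
    also have "x + y - (a + b) = (y - b) + (x - a)" by simp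
    also have "ennreal (p ((y - b) + (x - a))) \<le> ennreal (real_kplus nrm (p (y - b)) (p (x - a)))"
      using p_add_kplus V' by (intro ennreal_leI) blast
    finally show "seminorm_dist (x + y) {a + b |a b. a \<in> C \<and> b \<in> D} \<le> kplus nrm (ennreal (p (y - b))) (ennreal (p (x - a)))"
      using V' p_nonneg by (simp add: ennreal_real_kplus)
  qed
  then show "seminorm_dist (x + y) {a + b |a b. a \<in> C \<and> b \<in> D} \<le> kplus nrm (ennreal (p (x - a))) (seminorm_dist y D)"
    by (simp add: kplus_commute)
qed

lemma seminorm_dist_le_kplus:
  assumes x: "x \<in> V" "y \<in> V" "C \<subseteq> V"
  shows "seminorm_dist x C \<le> kplus nrm (ennreal (p (x - y))) (seminorm_dist y C)"
proof -
  have "seminorm_dist x C \<le> kplus nrm (seminorm_dist y C) (ennreal (p (x - y)))"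
    unfolding seminorm_dist_def[of y]
  proof (rule le_kplus_INF)
    fix c assume c: "c \<in> C"
    have V': "x - y \<in> V" "y - c \<in> V" using c assms subspace_diff[OF V] by blast+
    have "seminorm_dist x C \<le> ennreal (p (x - c))" using c by (rule seminorm_dist_le)
    also have "x - c = (y - c) + (x - y)" by simp
    also have "ennreal (p ((y - c) + (x - y))) \<le> ennreal (real_kplus nrm (p (y - c)) (p (x - y)))"
      using p_add_kplus V' by (intro ennreal_leI) blast
    finally show "seminorm_dist x C \<le> kplus nrm (ennreal (p (y - c))) (ennreal (p (x - y)))"
      using V' p_nonneg by (simp add: ennreal_real_kplus)
  qed
  then show ?thesis by (simp add: kplus_commute)
qed

lemma seminorm_dist_lipschitz:
  assumes "x \<in> V" "y \<in> V" "C \<subseteq> V"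
  shows "seminorm_dist x C \<le> seminorm_dist y C + ennreal (p (x - y))"
proof -
  have "kplus nrm (ennreal (p (x - y))) (seminorm_dist y C) \<le> seminorm_dist y C + ennreal (p (x - y))"
    by (simp add: kplus_def add.commute add_increasing)
  then show ?thesis using seminorm_dist_le_kplus[OF assms] by simp
qed

lemma seminorm_dist_lessD:
  assumes "seminorm_dist x C < ennreal e"
  shows "\<exists>c\<in>C. p (x - c) < e"
  using assms unfolding seminorm_dist_def INF_less_iff
  by (metis ennreal_less_iff ennreal_neg linorder_not_less not_less_zero ennreal_leI)

text \<open>The distance to a set sees exactly its closure. Together with \<open>seminorm_dist_closure\<close> this
  turns statements about closures in axioms (N1), (N4) and (N5) into statements about the sets.\<close>

lemma seminorm_dist_eq_0_iff:
  assumes L: "L \<subseteq> V" and A: "A \<subseteq> L" and x: "x \<in> L"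
  shows "seminorm_dist x A = 0 \<longleftrightarrow> x \<in> subtopology Tp L closure_of A"
proof
  assume 0: "seminorm_dist x A = 0"
  show "x \<in> subtopology Tp L closure_of A"
    unfolding in_closure_of
  proof (intro conjI allI impI)
    show "x \<in> topspace (subtopology Tp L)" using x L by (auto simp: topspace_seminorm_topology)
    fix G assume "x \<in> G \<and> openin (subtopology Tp L) G"
    then obtain H where H: "openin Tp H" "G = H \<inter> L" "x \<in> H" by (auto simp: openin_subtopology)
    then obtain e where e: "e > 0" "\<forall>y\<in>V. p (y - x) < e \<longrightarrow> y \<in> H"
      unfolding openin_seminorm_topology by blast
    obtain c where "c \<in> A" "p (x - c) < e" using seminorm_dist_lessD[of x A e] 0 e by auto
    then show "\<exists>y. y \<in> A \<and> y \<in> G"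
      using e H A L x p_diff_commute[of x c] by (intro exI[of _ c]) (auto simp: subset_iff)
  qed
next
  assume cl: "x \<in> subtopology Tp L closure_of A"
  have "seminorm_dist x A \<le> 0 + ennreal e" if e: "0 < e" for e
  proof -
    have xV: "x \<in> V" using x L by auto
    have "openin (subtopology Tp L) ({y \<in> V. p (y - x) < e} \<inter> L)"
      using openin_ball[OF xV] by (auto simp: openin_subtopology)
    moreover have "x \<in> {y \<in> V. p (y - x) < e} \<inter> L" using xV x e by (simp add: p_0)
    ultimately have "\<exists>c. c \<in> A \<and> c \<in> {y \<in> V. p (y - x) < e} \<inter> L"
      using cl[unfolded in_closure_of, THEN conjunct2, rule_format, of "{y \<in> V. p (y - x) < e} \<inter> L"]
      by blast
    then obtain c where c: "c \<in> A" "c \<in> V" "p (c - x) < e" by auto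
    have "seminorm_dist x A \<le> ennreal (p (x - c))" using c(1) by (rule seminorm_dist_le)
    also have "\<dots> \<le> ennreal e" using c p_diff_commute[OF xV c(2)] by (intro ennreal_leI) simp
    finally show ?thesis by simp
  qed
  then show "seminorm_dist x A = 0"
    using ennreal_le_epsilon[of 0 "seminorm_dist x A"] by simp
qed

lemma seminorm_dist_closure:
  assumes L: "L \<subseteq> V" and A: "A \<subseteq> L" and x: "x \<in> V"
  shows "seminorm_dist x (subtopology Tp L closure_of A) = seminorm_dist x A"
proof (rule antisym)
  have "A \<subseteq> subtopology Tp L closure_of A"
    using A L by (intro closure_of_subset) (auto simp: topspace_seminorm_topology)
  then show "seminorm_dist x (subtopology Tp L closure_of A) \<le> seminorm_dist x A"
    by (rule seminorm_dist_antimono)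
  show "seminorm_dist x A \<le> seminorm_dist x (subtopology Tp L closure_of A)"
    unfolding seminorm_dist_def[of x "_ closure_of _"]
  proof (rule INF_greatest)
    fix c assume c: "c \<in> subtopology Tp L closure_of A"
    then have cL: "c \<in> L"
      using closure_of_subset_topspace by (fastforce simp: topspace_seminorm_topology)
    then have "seminorm_dist c A = 0" using seminorm_dist_eq_0_iff[OF L A cL] c by blast
    then show "seminorm_dist x A \<le> ennreal (p (x - c))"
      using seminorm_dist_lipschitz[of x c A] x cL L A by auto
  qed
qed

lemma seminorm_dist_scale:
  assumes x: "x \<in> V" and C: "C \<subseteq> V" and l: "l \<noteq> 0"
  shows "seminorm_dist (sc l x) (sc l ` C) = ennreal (nrm l) * seminorm_dist x C"
proof -
  have le: "seminorm_dist (sc l x) (sc l ` C) \<le> ennreal (nrm l) * seminorm_dist x C"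
    if "x \<in> V" "C \<subseteq> V" "l \<noteq> 0" for l x C
  proof -
    have eq: "ennreal (p (sc l x - sc l c)) = ennreal (nrm l) * ennreal (p (x - c))" if "c \<in> C" for c
    proof -
      have "x - c \<in> V" using that \<open>C \<subseteq> V\<close> \<open>x \<in> V\<close> subspace_diff[OF V] by blast
      then show ?thesis
        using p_scale[of "x - c" l] p_nonneg nrm_nonneg
        by (simp add: scale_right_diff_distrib ennreal_mult)
    qed
    have inv: "ennreal (inverse (nrm l)) * ennreal (nrm l) = 1"
      using nrm_pos[OF \<open>l \<noteq> 0\<close>] by (simp add: ennreal_mult[symmetric] ennreal_1[symmetric] del: ennreal_1)
    have "ennreal (inverse (nrm l)) * seminorm_dist (sc l x) (sc l ` C) \<le> seminorm_dist x C"
      unfolding seminorm_dist_def[of x]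
    proof (rule INF_greatest)
      fix c assume c: "c \<in> C"
      have "ennreal (inverse (nrm l)) * seminorm_dist (sc l x) (sc l ` C)
          \<le> ennreal (inverse (nrm l)) * (ennreal (nrm l) * ennreal (p (x - c)))"
        using seminorm_dist_le[of "sc l c" "sc l ` C" "sc l x"] c eq[OF c]
        by (intro mult_left_mono) auto
      then show "ennreal (inverse (nrm l)) * seminorm_dist (sc l x) (sc l ` C) \<le> ennreal (p (x - c))"
        by (simp add: mult.assoc[symmetric] inv)
    qed
    from mult_left_mono[OF this, of "ennreal (nrm l)"]
    show ?thesis using inv by (simp add: mult.assoc[symmetric] mult.commute[of "ennreal (nrm l)" "ennreal (inverse (nrm l))"])
  qed
  have "seminorm_dist x C = seminorm_dist (sc (inverse l) (sc l x)) (sc (inverse l) ` sc l ` C)"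
    using l by (simp add: image_image)
  also have "\<dots> \<le> ennreal (nrm (inverse l)) * seminorm_dist (sc l x) (sc l ` C)"
    using x C l subspace_scale[OF V] by (intro le) auto
  finally have "ennreal (nrm l) * seminorm_dist x C \<le> ennreal (nrm l) * (ennreal (nrm (inverse l)) * seminorm_dist (sc l x) (sc l ` C))"
    by (rule mult_left_mono) simp
  also have "ennreal (nrm l) * (ennreal (nrm (inverse l)) * seminorm_dist (sc l x) (sc l ` C)) = seminorm_dist (sc l x) (sc l ` C)"
    using nrm_pos[OF l] l
    by (simp add: nrm_inverse mult.assoc[symmetric] ennreal_mult[symmetric])
  finally show ?thesis using le[OF x C l] by (simp add: antisym)
qed

text \<open>In a topology given by a seminorm the distance to a set is a \<open>\<kappa>\<close>-norm on every subset \<open>L\<close>: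
  the axioms are translation invariance, homogeneity and the triangle inequality of the
  seminorm, passed to infima. Sums, multiples and translates that stay inside \<open>L\<close> are formed in
  the surrounding subspace \<open>V\<close>, and \<open>L\<close> only decides in which set closures are taken.\<close>

theorem kappa_norm_on_seminorm_dist:
  assumes L: "L \<subseteq> V"
  shows "kappa_norm_on nrm sc Tp L seminorm_dist"
proof -
  define S where "S = closed_gdeltas (subtopology Tp L)"
  define cl where "cl = (\<lambda>A. subtopology Tp L closure_of A)"
  have top: "topspace (subtopology Tp L) = L" using L by (auto simp: topspace_seminorm_topology)
  have SL: "C \<subseteq> L" if "C \<in> S" for C
    using that closedin_subset[of "subtopology Tp L"] by (auto simp: S_def closed_gdeltas_def top)
  have SV: "C \<subseteq> V" if "C \<in> S" for C using SL[OF that] L by blast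
  have cl_S: "cl C = C" if "C \<in> S" for C
    using that by (simp add: S_def closed_gdeltas_def closure_of_closedin cl_def)
  have xV: "x \<in> V" if "x \<in> L" for x using that L by blast
  have N1: "seminorm_dist x C = 0 \<longleftrightarrow> x \<in> C" if "x \<in> L" "C \<in> S" for x C
    using seminorm_dist_eq_0_iff[OF L SL[OF that(2)] that(1)] cl_S[OF that(2)] by (simp add: cl_def)
  have N3: "\<exists>U. zero_nhd Tp U \<and> (\<forall>x\<in>L. \<forall>y\<in>L. x - y \<in> U \<longrightarrow>
      seminorm_dist x C \<le> seminorm_dist y C + ennreal e \<and> seminorm_dist y C \<le> seminorm_dist x C + ennreal e)"
    if C: "C \<in> S" and e: "0 < e" for C e
  proof (intro exI conjI ballI impI)
    show "zero_nhd Tp {x \<in> V. p x < e}" using e by (auto simp: zero_nhd_seminorm_topology)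
    fix x y assume xy: "x \<in> L" "y \<in> L" "x - y \<in> {x \<in> V. p x < e}"
    then have "ennreal (p (x - y)) \<le> ennreal e" "ennreal (p (y - x)) \<le> ennreal e"
      using p_diff_commute[of x y] xV by (auto intro!: ennreal_leI)
    then show "seminorm_dist x C \<le> seminorm_dist y C + ennreal e"
      "seminorm_dist y C \<le> seminorm_dist x C + ennreal e"
      using seminorm_dist_lipschitz[of x y C] seminorm_dist_lipschitz[of y x C] xy xV SV[OF C]
      by (meson add_left_mono order_trans)+
  qed
  have N4: "seminorm_dist x (cl (\<Union>F)) = (INF C\<in>F. seminorm_dist x C)"
    if "F \<subseteq> S" "x \<in> L" for F x
  proof -
    have "\<Union>F \<subseteq> L" using that(1) SL by blast
    then have "seminorm_dist x (cl (\<Union>F)) = seminorm_dist x (\<Union>F)"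
      using seminorm_dist_closure L xV[OF that(2)] by (simp add: cl_def)
    also have "\<dots> = (INF C\<in>F. seminorm_dist x C)"
      unfolding seminorm_dist_def
      by (rule antisym) (auto intro!: INF_greatest intro: INF_lower2 INF_lower)
    finally show ?thesis .
  qed
  have N5a: "seminorm_dist (x + y) (cl {a + b |a b. a \<in> C \<and> b \<in> D}) \<le> kplus nrm (seminorm_dist x C) (seminorm_dist y D)"
    if "x \<in> L" "y \<in> L" "C \<in> S" "D \<in> S" "{a + b |a b. a \<in> C \<and> b \<in> D} \<subseteq> L" for x y C D
    using seminorm_dist_add[of x y C D] that xV SV seminorm_dist_closure[OF L that(5), of "x + y"]
      subspace_add[OF V]
    by (simp add: cl_def)
  have N5b: "seminorm_dist x C \<le> kplus nrm (seminorm_dist x D) (SUP z\<in>D. seminorm_dist z C)"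
    if "x \<in> L" "C \<in> S" "D \<in> S" for x C D
    unfolding seminorm_dist_def[of x D]
  proof (rule le_kplus_INF)
    fix z assume z: "z \<in> D"
    then have "seminorm_dist x C \<le> kplus nrm (ennreal (p (x - z))) (seminorm_dist z C)"
      using that SV xV by (intro seminorm_dist_le_kplus) auto
    also have "\<dots> \<le> kplus nrm (ennreal (p (x - z))) (SUP z\<in>D. seminorm_dist z C)"
      using z by (intro kplus_mono SUP_upper) auto
    finally show "seminorm_dist x C \<le> kplus nrm (ennreal (p (x - z))) (SUP z\<in>D. seminorm_dist z C)" .
  qed
  have N7: "seminorm_dist (x + y) ((+) y ` C) = seminorm_dist x C" for x y C
    by (simp add: seminorm_dist_def image_image)
  have N8: "seminorm_dist x {} = \<infinity>" "C \<noteq> {} \<Longrightarrow> seminorm_dist x C < \<infinity>" for x C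
    by (auto simp: seminorm_dist_def INF_less_iff)
  show ?thesis
    unfolding kappa_norm_on_def Let_def S_def[symmetric] cl_def[symmetric]
  proof (intro conjI ballI allI impI, goal_cases)
    case (2 x C D) then show ?case by (intro seminorm_dist_antimono)
  next
    case (3 C e) then show ?case by (rule N3)
  next
    case (4 F x) then show ?case by (intro N4) auto
  next
    case (5 x y C D) then show ?case by (intro N5a) auto
  next
    case (6 x C D) then show ?case by (rule N5b)
  next
    case (7 x C l) then show ?case using xV SV by (intro seminorm_dist_scale) auto
  qed (use N1 N7 N8 in auto)
qed

end

section \<open>Closed $G_\delta$ subspaces of a topological vector space\<close>

text \<open>Axiom (N4) speaks about well-ordered families, Zorn's lemma about chains. To pass from a chain to
  a well-ordered family with the same union, fix any well-order of all sets and keep the members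
  of the chain that contain all of their predecessors in it.\<close>

lemma chain_has_wellordered_cofinal_subset:
  assumes chain: "\<And>A B. A \<in> F \<Longrightarrow> B \<in> F \<Longrightarrow> A \<subseteq> B \<or> B \<subseteq> A"
  obtains W where "W \<subseteq> F" and "\<And>A. A \<in> F \<Longrightarrow> \<exists>B\<in>W. A \<subseteq> B"
    and "\<And>G. G \<subseteq> W \<Longrightarrow> G \<noteq> {} \<Longrightarrow> \<exists>C\<in>G. \<forall>D\<in>G. C \<subseteq> D"
proof -
  obtain r :: "'a set rel" where r: "well_order_on UNIV r" using well_order_on by blast
  have least: "\<exists>c\<in>G. \<forall>d\<in>G. (c, d) \<in> r" if G: "G \<noteq> {}" for G
  proof -
    have lin: "linear_order_on UNIV r" and wf: "wf (r - Id)"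
      using r by (auto simp: well_order_on_def)
    obtain c where c: "c \<in> G" "\<And>d. (d, c) \<in> r - Id \<Longrightarrow> d \<notin> G"
      by (rule wfE_min'[OF wf G]) blast
    have "(c, d) \<in> r" if "d \<in> G" for d
      using c(2)[of d] that lin
      by (cases "c = d") (auto simp: linear_order_on_def partial_order_on_def preorder_on_def
          refl_on_def total_on_def)
    then show ?thesis using c(1) by blast
  qed
  have anti: "c = d" if "(c, d) \<in> r" "(d, c) \<in> r" for c d
    using r that by (auto simp: well_order_on_def linear_order_on_def partial_order_on_def antisym_def)
  \<comment> \<open>Within \<open>W\<close> the \<open>r\<close>-earlier of two sets is included in the later one. Cofinality: the \<open>r\<close>-least member above a given \<open>A\<close> lies in \<open>W\<close>.\<close>
  define W where "W = {c \<in> F. \<forall>d\<in>F. (d, c) \<in> r \<longrightarrow> d \<subseteq> c}"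
  have "\<exists>B\<in>W. A \<subseteq> B" if A: "A \<in> F" for A
  proof -
    obtain B where B: "B \<in> F" "A \<subseteq> B" and min: "\<And>D. D \<in> F \<Longrightarrow> A \<subseteq> D \<Longrightarrow> (B, D) \<in> r"
      using least[of "{B \<in> F. A \<subseteq> B}"] A by blast
    have "D \<subseteq> B" if D: "D \<in> F" "(D, B) \<in> r" for D
    proof (cases "A \<subseteq> D")
      case True
      then show ?thesis using min[OF D(1)] anti D(2) by blast
    next
      case False
      then show ?thesis using chain[OF A D(1)] B(2) by blast
    qed
    then show ?thesis using B unfolding W_def by blast
  qed
  moreover have "\<exists>C\<in>G. \<forall>D\<in>G. C \<subseteq> D" if G: "G \<subseteq> W" "G \<noteq> {}" for G
  proof -
    obtain c where c: "c \<in> G" "\<forall>d\<in>G. (c, d) \<in> r" using least[OF G(2)] by blast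
    have "c \<subseteq> d" if d: "d \<in> G" for d
    proof -
      have "c \<in> F" "d \<in> W" using c(1) d G(1) by (auto simp: W_def)
      then show ?thesis using c(2) d by (simp add: W_def)
    qed
    then show ?thesis using c(1) by blast
  qed
  moreover have "W \<subseteq> F" by (auto simp: W_def)
  ultimately show thesis by (intro that)
qed

lemma (in valued_field) scale_nhd:
  assumes T: "topological_vector_space nrm sc T"
    and W: "openin T W" and x: "x \<in> topspace T" and lx: "sc l x \<in> W"
  obtains d V where "0 < d" "openin T V" "x \<in> V"
    "\<And>m y. nrm (m - l) < d \<Longrightarrow> y \<in> V \<Longrightarrow> sc m y \<in> W"
proof -
  let ?P = "prod_topology (field_topology nrm) T"
  have ftop: "topspace (field_topology nrm) = UNIV"
    using Metric_space.topspace_mtopology[OF Metric_space_nrm] by (simp add: field_topology_def)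
  have "openin ?P {z \<in> topspace ?P. (case z of (l, x) \<Rightarrow> sc l x) \<in> W}"
    using T W unfolding topological_vector_space_def
    by (blast intro: openin_continuous_map_preimage)
  moreover have "(l, x) \<in> {z \<in> topspace ?P. (case z of (l, x) \<Rightarrow> sc l x) \<in> W}"
    using lx x ftop by simp
  ultimately obtain U V where UV: "openin (field_topology nrm) U" "openin T V" "l \<in> U" "x \<in> V"
    "U \<times> V \<subseteq> {z \<in> topspace ?P. (case z of (l, x) \<Rightarrow> sc l x) \<in> W}"
    unfolding openin_prod_topology_alt by meson
  then obtain d where "d > 0" "\<forall>m. nrm (m - l) < d \<longrightarrow> m \<in> U"
    unfolding openin_field_topology by blast
  then show thesis using UV by (intro that[of d V]) (fastforce simp: subset_iff)+
qed

locale tvs = valued_field nrm + vector_space sc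
  for nrm :: "'k::field \<Rightarrow> real" and sc :: "'k \<Rightarrow> 'a::ab_group_add \<Rightarrow> 'a" +
  fixes T :: "'a topology"
  assumes tvs: "topological_vector_space nrm sc T" and top: "topspace T = UNIV"
begin

lemma openin_plus: "openin T G \<Longrightarrow> openin T {y. a + y \<in> G}"
  using openin_translate[OF tvs] top by simp

lemma openin_Union_translates: "openin T G \<Longrightarrow> openin T {a + y |a y. a \<in> A \<and> y \<in> G}"
proof -
  assume G: "openin T G"
  have "{a + y |a y. a \<in> A \<and> y \<in> G} = (\<Union>a\<in>A. {y. - a + y \<in> G})"
  proof (intro equalityI subsetI)
    fix z assume "z \<in> {a + y |a y. a \<in> A \<and> y \<in> G}"
    then obtain a y where "a \<in> A" "y \<in> G" "z = a + y" by blast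
    then show "z \<in> (\<Union>a\<in>A. {y. - a + y \<in> G})" by (intro UN_I[of a]) auto
  next
    fix z assume "z \<in> (\<Union>a\<in>A. {y. - a + y \<in> G})"
    then obtain a where "a \<in> A" "- a + z \<in> G" by blast
    moreover have "z = a + (- a + z)" by simp
    ultimately show "z \<in> {a + y |a y. a \<in> A \<and> y \<in> G}" by blast
  qed
  also have "openin T \<dots>" using openin_plus[OF G] by blast
  finally show ?thesis .
qed

lemma add_nhd:
  assumes W: "openin T W" "0 \<in> W"
  obtains V where "openin T V" "0 \<in> V" "\<And>x y. x \<in> V \<Longrightarrow> y \<in> V \<Longrightarrow> x + y \<in> W"
proof -
  have "openin (prod_topology T T) {z \<in> topspace (prod_topology T T). (case z of (x, y) \<Rightarrow> x + y) \<in> W}"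
    using tvs W unfolding topological_vector_space_def
    by (blast intro: openin_continuous_map_preimage)
  moreover have "(0, 0) \<in> {z \<in> topspace (prod_topology T T). (case z of (x, y) \<Rightarrow> x + y) \<in> W}"
    using W top by simp
  ultimately obtain U V where "openin T U" "openin T V" "0 \<in> U" "0 \<in> V"
    "U \<times> V \<subseteq> {z \<in> topspace (prod_topology T T). (case z of (x, y) \<Rightarrow> x + y) \<in> W}"
    unfolding openin_prod_topology_alt by meson
  then show thesis by (intro that[of "U \<inter> V"]) auto
qed

lemmas scale_nhd' = scale_nhd[OF tvs, unfolded top, OF _ UNIV_I]

lemma openin_scale_vimage: "openin T G \<Longrightarrow> openin T {x. sc l x \<in> G}"
proof (subst openin_subopen, intro ballI)
  fix x assume G: "openin T G" and x: "x \<in> {x. sc l x \<in> G}"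
  then obtain d V where V: "0 < d" "openin T V" "x \<in> V" "\<And>m y. nrm (m - l) < d \<Longrightarrow> y \<in> V \<Longrightarrow> sc m y \<in> G"
    using scale_nhd'[of G l x] by (metis mem_Collect_eq)
  then have "V \<subseteq> {x. sc l x \<in> G}" by (auto simp: nrm_0)
  then show "\<exists>V. openin T V \<and> x \<in> V \<and> V \<subseteq> {x. sc l x \<in> G}" using V by blast
qed

text \<open>Continuity of scalar multiplication at zero controls small scalars only; rescaling the
  neighbourhood of the vector controls scalars up to any bound \<open>R\<close>.\<close>

lemma bounded_scale_nhd:
  assumes W: "openin T W" "0 \<in> W"
  obtains V where "openin T V" "0 \<in> V" "\<And>l x. nrm l \<le> R \<Longrightarrow> x \<in> V \<Longrightarrow> sc l x \<in> W"
proof -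
  obtain d U where U: "0 < d" "openin T U" "0 \<in> U" "\<And>m y. nrm (m - 0) < d \<Longrightarrow> y \<in> U \<Longrightarrow> sc m y \<in> W"
    using scale_nhd'[of W 0 0] W by auto
  define M where "M = max R 1"
  obtain m where m: "m \<noteq> 0" "nrm m < d / M"
    using small_scalar[of "d / M"] U(1) by (auto simp: M_def)
  have M: "0 < M" "R \<le> M" by (auto simp: M_def)
  show thesis
  proof (rule that[of "{x. sc (inverse m) x \<in> U}"])
    show "openin T {x. sc (inverse m) x \<in> U}" using U by (intro openin_scale_vimage)
    show "0 \<in> {x. sc (inverse m) x \<in> U}" using U by simp
    fix l x assume l: "nrm l \<le> R" and x: "x \<in> {x. sc (inverse m) x \<in> U}"
    have "nrm (l * m) \<le> M * nrm m"
      unfolding nrm_mult using l M nrm_nonneg by (intro mult_right_mono) auto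
    also have "\<dots> < d" using m M by (simp add: field_simps)
    finally have "sc (l * m) (sc (inverse m) x) \<in> W" using x by (intro U(4)) auto
    then show "sc l x \<in> W" using m by (simp add: mult.assoc)
  qed
qed

lemma closure_approx:
  assumes "x \<in> T closure_of A" "openin T W" "0 \<in> W"
  shows "\<exists>y\<in>A. y - x \<in> W"
proof -
  have "openin T {y. - x + y \<in> W}" using assms by (intro openin_plus)
  moreover have "x \<in> {y. - x + y \<in> W}" using assms by simp
  ultimately have "\<exists>y. y \<in> A \<and> y \<in> {y. - x + y \<in> W}"
    using assms(1)[unfolded in_closure_of, THEN conjunct2, rule_format, of "{y. - x + y \<in> W}"] by blast
  then show ?thesis by auto
qed

text \<open>These subspaces will be the kernels of the seminorms that a \<open>\<kappa>\<close>-norm induces.\<close>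

definition gdelta_subspace :: "'a set \<Rightarrow> bool" where
  "gdelta_subspace N \<longleftrightarrow> N \<in> closed_gdeltas T \<and> subspace N"

lemma UNIV_closed_gdelta: "UNIV \<in> closed_gdeltas T"
  using closedin_topspace[of T] gdelta_in_topspace[of T] by (simp add: closed_gdeltas_def top)

lemma gdelta_subspace_INT:
  fixes N :: "nat \<Rightarrow> 'a set"
  assumes "\<And>n. gdelta_subspace (N n)"
  shows "gdelta_subspace (\<Inter>n. N n)"
proof -
  have "closedin T (\<Inter>n. N n)"
    using assms by (intro closedin_Inter) (auto simp: gdelta_subspace_def closed_gdeltas_def)
  moreover have "gdelta_in T (\<Inter>n. N n)"
    using assms by (intro gdelta_in_Inter) (auto simp: gdelta_subspace_def closed_gdeltas_def)
  moreover have "subspace (\<Inter>n. N n)"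
    using assms by (auto simp: gdelta_subspace_def subspace_def)
  ultimately show ?thesis by (simp add: gdelta_subspace_def closed_gdeltas_def)
qed

text \<open>A substitute for the seminorm of a neighbourhood \<open>W\<close>. Choose neighbourhoods \<open>f 0 = W\<close>,
  \<open>f 1\<close>, ... such that sums of two elements of \<open>f (n + 1)\<close>, and their multiples by scalars of norm
  at most \<open>n + 1\<close>, lie in \<open>f n\<close>. Their intersection \<open>N\<close> is a closed \<open>G\<^sub>\<delta>\<close> subspace. The union \<open>O'\<close> of the
  finite sums \<open>f 2 + ... + f (n + 1)\<close> is open and, as each such sum contains the closure of
  the preceding one, also the union of countably many closed sets. So the complement \<open>C\<close> of \<open>O'\<close> is a
  closed \<open>G\<^sub>\<delta>\<close> set; it contains the complement of \<open>W\<close>, and it is invariant under \<open>N\<close> because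
  \<open>N\<close> can be absorbed into one more summand of \<open>O'\<close>.\<close>

lemma gdelta_subspace_in_nhd:
  assumes W: "openin T W" "0 \<in> W"
  obtains N C where "gdelta_subspace N" "N \<subseteq> W" "C \<in> closed_gdeltas T" "0 \<notin> C" "- W \<subseteq> C"
    "\<And>x y. x \<in> C \<Longrightarrow> y \<in> N \<Longrightarrow> x + y \<in> C"
proof -
  define Q where "Q n U U' \<longleftrightarrow> (\<forall>x\<in>U'. \<forall>y\<in>U'. x + y \<in> U) \<and> (\<forall>l. nrm l \<le> real (Suc n) \<longrightarrow> (\<forall>x\<in>U'. sc l x \<in> U))"
    for n U U'
  have step: "\<exists>U'. (openin T U' \<and> 0 \<in> U') \<and> Q n U U'" if U: "openin T U" "0 \<in> U" for n U
  proof -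
    obtain A where A: "openin T A" "0 \<in> A" "\<And>x y. x \<in> A \<Longrightarrow> y \<in> A \<Longrightarrow> x + y \<in> U"
      using add_nhd[OF U] by blast
    obtain B where B: "openin T B" "0 \<in> B" "\<And>l x. nrm l \<le> real (Suc n) \<Longrightarrow> x \<in> B \<Longrightarrow> sc l x \<in> U"
      using bounded_scale_nhd[OF U] by blast
    show ?thesis using A B by (intro exI[of _ "A \<inter> B"]) (auto simp: Q_def)
  qed
  have "\<exists>f. \<forall>n. ((openin T (f n) \<and> 0 \<in> f n) \<and> (n = 0 \<longrightarrow> f n = W)) \<and> Q n (f n) (f (Suc n))"
  proof (rule dependent_nat_choice)
    show "\<exists>U. (openin T U \<and> 0 \<in> U) \<and> ((0::nat) = 0 \<longrightarrow> U = W)" using W by blast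
    show "\<exists>U'. ((openin T U' \<and> 0 \<in> U') \<and> (Suc n = 0 \<longrightarrow> U' = W)) \<and> Q n U U'"
      if "(openin T U \<and> 0 \<in> U) \<and> (n = 0 \<longrightarrow> U = W)" for U n
      using step[of U n] that by auto
  qed
  then obtain f where f: "\<And>n. openin T (f n)" "\<And>n. 0 \<in> f n" "f 0 = W" "\<And>n. Q n (f n) (f (Suc n))"
    by blast
  have add: "x + y \<in> f n" if "x \<in> f (Suc n)" "y \<in> f (Suc n)" for x y n
    using f(4)[of n] that by (auto simp: Q_def)
  have scale: "sc l x \<in> f n" if "x \<in> f (Suc n)" "nrm l \<le> real (Suc n)" for l x n
    using f(4)[of n] that by (auto simp: Q_def)
  have Suc_sub: "f (Suc n) \<subseteq> f n" for n using add[of _ n 0] f(2) by auto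
  have mono: "m \<le> n \<Longrightarrow> f n \<subseteq> f m" for m n
    using lift_Suc_antimono_le[of f] Suc_sub by blast
  have neg: "- x \<in> f n" if "x \<in> f (Suc n)" for x n
    using scale[OF that, of "- 1"] by (simp add: nrm_minus_1)
  define N where "N = (\<Inter>n. f n)"
  have "subspace N"
  proof (rule subspaceI)
    show "0 \<in> N" using f(2) by (simp add: N_def)
    show "x + y \<in> N" if "x \<in> N" "y \<in> N" for x y using that add by (auto simp: N_def)
    show "sc l x \<in> N" if x: "x \<in> N" for l x
    proof -
      have "sc l x \<in> f n" for n
      proof -
        obtain k where k: "nrm l \<le> real k" using real_arch_simple by blast
        have "sc l x \<in> f (n + k)" using x k by (intro scale) (auto simp: N_def)
        then show ?thesis using mono[of n "n + k"] by auto
      qed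
      then show ?thesis by (simp add: N_def)
    qed
  qed
  have cl_f: "T closure_of f (Suc n) \<subseteq> f n" for n
  proof
    fix x assume x: "x \<in> T closure_of f (Suc n)"
    obtain y where y: "y \<in> f (Suc n)" "y - x \<in> f (Suc (Suc n))"
      using closure_approx[OF x f(1) f(2)] by blast
    then show "x \<in> f n" using add[OF y(1) neg[OF y(2)]] by simp
  qed
  have N_cl: "N = (\<Inter>n. T closure_of f n)"
  proof
    have "f n \<subseteq> T closure_of f n" for n by (rule closure_of_subset) (simp add: top)
    then show "N \<subseteq> (\<Inter>n. T closure_of f n)" by (auto simp: N_def)
    show "(\<Inter>n. T closure_of f n) \<subseteq> N" unfolding N_def using cl_f by blast
  qed
  have "closedin T N" unfolding N_cl by (intro closedin_Inter) auto
  moreover have "gdelta_in T N"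
    unfolding N_def by (intro gdelta_in_Inter) (auto intro: open_imp_gdelta_in f(1))
  ultimately have "gdelta_subspace N"
    using \<open>subspace N\<close> by (simp add: gdelta_subspace_def closed_gdeltas_def)

  define q where "q = rec_nat {0} (\<lambda>n A. {a + y |a y. a \<in> A \<and> y \<in> f (Suc (Suc n))})"
  have q_0: "q 0 = {0}" and q_Suc: "q (Suc n) = {a + y |a y. a \<in> q n \<and> y \<in> f (Suc (Suc n))}" for n
    by (simp_all add: q_def)
  \<comment> \<open>The last summand leaves room for one more element of the same neighbourhood; hence the index \<open>Suc n\<close>.\<close>
  have q_W: "a + y \<in> W" if "a \<in> q n" "y \<in> f (Suc n)" for a y n
    using that
  proof (induction n arbitrary: a y)
    case 0
    then show ?case using Suc_sub[of 0] f(3) by (auto simp: q_0)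
  next
    case (Suc n)
    then obtain b z where b: "a = b + z" "b \<in> q n" "z \<in> f (Suc (Suc n))" by (auto simp: q_Suc)
    then have "b + (z + y) \<in> W" using add[OF b(3) Suc.prems(2)] Suc.IH by blast
    then show ?case by (simp add: b add.assoc)
  qed
  define O' where "O' = (\<Union>n. q n)"
  have q_cl: "T closure_of q n \<subseteq> q (Suc n)" for n
  proof
    fix x assume x: "x \<in> T closure_of q n"
    obtain y where y: "y \<in> q n" "y - x \<in> f (Suc (Suc (Suc n)))"
      using closure_approx[OF x f(1) f(2)] by blast
    have "x = y + - (y - x)" by simp
    then show "x \<in> q (Suc n)" unfolding q_Suc using y neg by blast
  qed
  have q_sub_cl: "q n \<subseteq> T closure_of q n" for n by (rule closure_of_subset) (simp add: top)
  have O_cl: "O' = (\<Union>n. T closure_of q n)" using q_cl q_sub_cl by (fastforce simp: O'_def)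
  have O_Suc: "O' = (\<Union>n. q (Suc n))" using q_cl q_sub_cl by (fastforce simp: O'_def)
  have "openin T O'"
    unfolding O_Suc q_Suc by (intro openin_Union) (auto intro: openin_Union_translates f(1))
  have "O' \<subseteq> W" using q_W[of _ _ 0] q_W f(2) by (fastforce simp: O'_def)
  have "0 \<in> O'" using q_0 by (auto simp: O'_def)
  have "closedin T (- O')"
    using \<open>openin T O'\<close> by (simp add: closedin_def top Compl_eq_Diff_UNIV double_diff)
  moreover have "gdelta_in T (- O')"
  proof -
    have "- O' = (\<Inter>n. - (T closure_of q n))" by (auto simp: O_cl)
    also have "gdelta_in T \<dots>"
    proof (intro gdelta_in_Inter)
      fix A assume "A \<in> range (\<lambda>n. - (T closure_of q n))"
      then obtain n where "A = topspace T - T closure_of q n" by (auto simp: top Compl_eq_Diff_UNIV)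
      then show "gdelta_in T A" by (auto intro!: open_imp_gdelta_in openin_diff)
    qed auto
    finally show ?thesis .
  qed
  ultimately have "- O' \<in> closed_gdeltas T" by (simp add: closed_gdeltas_def)
  moreover have "x + y \<in> - O'" if x: "x \<in> - O'" and y: "y \<in> N" for x y
  proof
    assume "x + y \<in> O'"
    then obtain n where n: "x + y \<in> q n" by (auto simp: O'_def)
    have "- y \<in> f (Suc (Suc n))" using subspace_neg[OF \<open>subspace N\<close> y] by (simp add: N_def)
    then have "(x + y) + - y \<in> q (Suc n)" unfolding q_Suc using n by blast
    then show False using x by (auto simp: O'_def)
  qed
  moreover have "N \<subseteq> W" using f(3) by (auto simp: N_def)
  ultimately show thesis
    using that[OF \<open>gdelta_subspace N\<close>, of "- O'"] \<open>O' \<subseteq> W\<close> \<open>0 \<in> O'\<close> by blast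
qed

lemma seminorm_superlevel_closed_gdelta:
  assumes p: "seminormed_space nrm sc UNIV p"
    and nhd: "\<And>e. 0 < e \<Longrightarrow> zero_nhd T {x. p x < e}"
  shows "{x. 1 \<le> p x} \<in> closed_gdeltas T"
proof -
  interpret p: seminormed_space nrm sc UNIV p by (rule p)
  have op: "openin T {x. P (p x)}"
    if P: "\<And>x. P x \<Longrightarrow> \<exists>e>0. \<forall>y. \<bar>y - x\<bar> < e \<longrightarrow> P y" for P
  proof (subst openin_subopen, intro ballI)
    fix x assume "x \<in> {x. P (p x)}"
    then obtain e where e: "e > 0" "\<And>y. \<bar>y - p x\<bar> < e \<Longrightarrow> P y" using P by blast
    obtain G where G: "openin T G" "0 \<in> G" "G \<subseteq> {x. p x < e}"
      using nhd[OF e(1)] by (auto simp: zero_nhd_def)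
    have "P (p y)" if "- x + y \<in> G" for y
    proof (rule e(2))
      have "p (y - x) < e" using G(3) that by auto
      moreover have "p y \<le> p (y - x) + p x" "p x \<le> p (y - x) + p y"
        using p.p_add[of "y - x" x] p.p_add[of "x - y" y] p.p_diff_commute[of x y] by auto
      ultimately show "\<bar>p y - p x\<bar> < e" by linarith
    qed
    then show "\<exists>U. openin T U \<and> x \<in> U \<and> U \<subseteq> {x. P (p x)}"
      using openin_plus[OF G(1), of "- x"] G(2) by (intro exI[of _ "{y. - x + y \<in> G}"]) auto
  qed
  have "openin T {x. p x < 1}"
  proof (rule op)
    fix x :: real assume "x < 1"
    then show "\<exists>e>0. \<forall>y. \<bar>y - x\<bar> < e \<longrightarrow> y < 1" by (intro exI[of _ "1 - x"]) auto
  qed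
  moreover have "topspace T - {x. 1 \<le> p x} = {x. p x < 1}" by (auto simp: top)
  ultimately have "closedin T {x. 1 \<le> p x}" by (simp add: closedin_def top)
  moreover have "gdelta_in T {x. 1 \<le> p x}"
  proof -
    have "{x. 1 \<le> p x} = (\<Inter>n. {x. 1 - 1 / real (Suc n) < p x})"
    proof (intro equalityI subsetI)
      fix x assume x: "x \<in> (\<Inter>n. {x. 1 - 1 / real (Suc n) < p x})"
      show "x \<in> {x. 1 \<le> p x}"
      proof (rule ccontr)
        assume "x \<notin> {x. 1 \<le> p x}"
        then obtain n where "1 / real (Suc n) < 1 - p x"
          using nat_approx_posE[of "1 - p x"] by auto
        moreover have "1 - 1 / real (Suc n) < p x" using x by blast
        ultimately show False by linarith
      qed
    next
      fix x assume x: "x \<in> {x. 1 \<le> p x}"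
      have "1 - 1 / real (Suc n) < p x" for n
      proof -
        have "0 < 1 / real (Suc n)" by simp
        moreover have "1 \<le> p x" using x by blast
        ultimately show ?thesis by linarith
      qed
      then show "x \<in> (\<Inter>n. {x. 1 - 1 / real (Suc n) < p x})" by blast
    qed
    also have "gdelta_in T \<dots>"
    proof (intro gdelta_in_Inter)
      fix A assume "A \<in> range (\<lambda>n. {x. 1 - 1 / real (Suc n) < p x})"
      then obtain n where A: "A = {x. 1 - 1 / real (Suc n) < p x}" by blast
      have "openin T A"
        unfolding A
      proof (rule op)
        fix x assume "1 - 1 / real (Suc n) < x"
        then show "\<exists>e>0. \<forall>y. \<bar>y - x\<bar> < e \<longrightarrow> 1 - 1 / real (Suc n) < y"
          by (intro exI[of _ "x - (1 - 1 / real (Suc n))"]) auto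
      qed
      then show "gdelta_in T A" by (rule open_imp_gdelta_in)
    qed auto
    finally show ?thesis .
  qed
  ultimately show ?thesis by (simp add: closed_gdeltas_def)
qed

end

section \<open>Spaces with a $\kappa$-norm are seminormable\<close>

locale kappa_normed_tvs = tvs nrm sc T
  for nrm :: "'k::field \<Rightarrow> real" and sc :: "'k \<Rightarrow> 'a::ab_group_add \<Rightarrow> 'a" and T :: "'a topology" +
  fixes \<rho> :: "'a \<Rightarrow> 'a set \<Rightarrow> ennreal"
  assumes kappa_norm: "kappa_norm_on nrm sc T UNIV \<rho>"
begin

lemmas kappa_norm_unfolded = kappa_norm[unfolded kappa_norm_on_def Let_def subtopology_UNIV]

lemma rho_eq_0: "C \<in> closed_gdeltas T \<Longrightarrow> \<rho> x C = 0 \<longleftrightarrow> x \<in> C"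
  using kappa_norm_unfolded[THEN conjunct1] by simp

lemma rho_antimono:
  "C \<in> closed_gdeltas T \<Longrightarrow> D \<in> closed_gdeltas T \<Longrightarrow> C \<subseteq> D \<Longrightarrow> \<rho> x D \<le> \<rho> x C"
  using kappa_norm_unfolded[THEN conjunct2, THEN conjunct1] by simp

lemma rho_uniform:
  assumes "C \<in> closed_gdeltas T" "0 < e"
  obtains U where "zero_nhd T U" "\<And>x y. x - y \<in> U \<Longrightarrow> \<rho> x C \<le> \<rho> y C + ennreal e"
  using kappa_norm_unfolded[THEN conjunct2, THEN conjunct2, THEN conjunct1] assms by (metis UNIV_I)

lemma rho_Union:
  assumes "F \<noteq> {}" "F \<subseteq> closed_gdeltas T"
    and "\<And>G. G \<subseteq> F \<Longrightarrow> G \<noteq> {} \<Longrightarrow> \<exists>C\<in>G. \<forall>D\<in>G. C \<subseteq> D"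
    and "T closure_of \<Union>F \<in> closed_gdeltas T"
  shows "\<rho> x (T closure_of \<Union>F) = (INF C\<in>F. \<rho> x C)"
  using kappa_norm_unfolded[THEN conjunct2, THEN conjunct2, THEN conjunct2, THEN conjunct1,
      rule_format, of F x] assms by simp

lemma rho_add:
  assumes "C \<in> closed_gdeltas T" "D \<in> closed_gdeltas T"
    and "T closure_of {a + b |a b. a \<in> C \<and> b \<in> D} \<in> closed_gdeltas T"
  shows "\<rho> (x + y) (T closure_of {a + b |a b. a \<in> C \<and> b \<in> D}) \<le> kplus nrm (\<rho> x C) (\<rho> y D)"
  using kappa_norm_unfolded[THEN conjunct2, THEN conjunct2, THEN conjunct2, THEN conjunct2,
      THEN conjunct1, rule_format, of x y C D] assms by simp

lemma rho_scale:
  assumes "C \<in> closed_gdeltas T" "l \<noteq> 0" "sc l ` C \<in> closed_gdeltas T"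
  shows "\<rho> (sc l x) (sc l ` C) = ennreal (nrm l) * \<rho> x C"
  using kappa_norm_unfolded[THEN conjunct2, THEN conjunct2, THEN conjunct2, THEN conjunct2,
      THEN conjunct2, THEN conjunct2, THEN conjunct1, rule_format, of x C l] assms by simp

lemma rho_finite: "C \<in> closed_gdeltas T \<Longrightarrow> C \<noteq> {} \<Longrightarrow> \<rho> x C < \<infinity>"
  using kappa_norm_unfolded[THEN conjunct2, THEN conjunct2, THEN conjunct2, THEN conjunct2,
      THEN conjunct2, THEN conjunct2, THEN conjunct2, THEN conjunct2, THEN conjunct2,
      rule_format, of x C] by simp

text \<open>The distance to a closed \<open>G\<^sub>\<delta>\<close> subspace \<open>N\<close> is a continuous seminorm with kernel \<open>N\<close>: the axioms (N5a)
  and (N6) become its triangle inequality and homogeneity because \<open>N + N = N\<close> and \<open>l N = N\<close>.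
  By (N2), a smaller kernel gives a pointwise larger seminorm, without any constant.\<close>

definition rho_seminorm :: "'a set \<Rightarrow> 'a \<Rightarrow> real" where
  "rho_seminorm N x = enn2real (\<rho> x N)"

lemma rho_seminorm_nonneg: "0 \<le> rho_seminorm N x"
  by (simp add: rho_seminorm_def)

lemma ennreal_rho_seminorm: "gdelta_subspace N \<Longrightarrow> ennreal (rho_seminorm N x) = \<rho> x N"
  using rho_finite[of N x] subspace_0[of N] unfolding gdelta_subspace_def rho_seminorm_def
  by (subst ennreal_enn2real) auto

lemma rho_seminorm_eq_0: "gdelta_subspace N \<Longrightarrow> rho_seminorm N x = 0 \<longleftrightarrow> x \<in> N"
  using rho_eq_0[of N x] ennreal_rho_seminorm[of N x] rho_seminorm_nonneg[of N x]
  by (metis ennreal_0 ennreal_eq_0_iff gdelta_subspace_def order_antisym)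

lemma rho_seminorm_antimono:
  assumes "gdelta_subspace N" "gdelta_subspace M" "N \<subseteq> M"
  shows "rho_seminorm M x \<le> rho_seminorm N x"
  using rho_antimono[of N M x] assms rho_seminorm_nonneg
  by (simp add: ennreal_rho_seminorm[symmetric] ennreal_le_iff gdelta_subspace_def)

lemma seminormed_space_rho_seminorm:
  assumes N: "gdelta_subspace N"
  shows "seminormed_space nrm sc UNIV (rho_seminorm N)"
proof unfold_locales
  have S: "N \<in> closed_gdeltas T" and sub: "subspace N" using N by (auto simp: gdelta_subspace_def)
  have eN: "ennreal (rho_seminorm N x) = \<rho> x N" for x using N by (rule ennreal_rho_seminorm)
  show "subspace UNIV" by (rule subspace_UNIV)
  show "0 \<le> rho_seminorm N x" for x by (rule rho_seminorm_nonneg)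
  fix x y :: 'a and l
  show "rho_seminorm N (sc l x) = nrm l * rho_seminorm N x"
  proof (cases "l = 0")
    case True
    then show ?thesis using rho_seminorm_eq_0[OF N, of 0] subspace_0[OF sub] by (simp add: nrm_0)
  next
    case False
    have "sc l ` N = N"
    proof
      show "sc l ` N \<subseteq> N" using subspace_scale[OF sub] by blast
      show "N \<subseteq> sc l ` N"
      proof
        fix z assume "z \<in> N"
        then have "sc (inverse l) z \<in> N" by (rule subspace_scale[OF sub])
        moreover have "z = sc l (sc (inverse l) z)" using False by simp
        ultimately show "z \<in> sc l ` N" by blast
      qed
    qed
    then have "\<rho> (sc l x) N = ennreal (nrm l) * \<rho> x N"
      using rho_scale[OF S False, of x] S by simp
    then show ?thesis
      unfolding rho_seminorm_def using nrm_nonneg by (simp add: enn2real_mult)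
  qed
  have "{a + b |a b. a \<in> N \<and> b \<in> N} = N"
  proof
    show "{a + b |a b. a \<in> N \<and> b \<in> N} \<subseteq> N" using subspace_add[OF sub] by blast
    show "N \<subseteq> {a + b |a b. a \<in> N \<and> b \<in> N}" using subspace_0[OF sub] by force
  qed
  moreover have "T closure_of N = N" using S by (simp add: closed_gdeltas_def closure_of_closedin)
  ultimately have "\<rho> (x + y) N \<le> kplus nrm (\<rho> x N) (\<rho> y N)"
    using rho_add[OF S S, of x y] S by simp
  then have "ennreal (rho_seminorm N (x + y))
      \<le> ennreal (real_kplus nrm (rho_seminorm N x) (rho_seminorm N y))"
    by (simp add: ennreal_real_kplus rho_seminorm_nonneg eN)
  then show "rho_seminorm N (x + y) \<le> real_kplus nrm (rho_seminorm N x) (rho_seminorm N y)"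
    by (simp add: ennreal_le_iff real_kplus_nonneg rho_seminorm_nonneg)
qed

lemma zero_nhd_mono: "zero_nhd T U \<Longrightarrow> U \<subseteq> W \<Longrightarrow> zero_nhd T W"
  unfolding zero_nhd_def top by blast

lemma zero_nhd_rho_seminorm:
  assumes N: "gdelta_subspace N" and e: "0 < e"
  shows "zero_nhd T {x. rho_seminorm N x < e}"
proof -
  have S: "N \<in> closed_gdeltas T" "0 \<in> N" using N subspace_0 by (auto simp: gdelta_subspace_def)
  obtain U where U: "zero_nhd T U" "\<And>x y. x - y \<in> U \<Longrightarrow> \<rho> x N \<le> \<rho> y N + ennreal (e / 2)"
    using rho_uniform[OF S(1), of "e / 2"] e by auto
  have "rho_seminorm N x < e" if "x \<in> U" for x
  proof -
    have "ennreal (rho_seminorm N x) \<le> ennreal (e / 2)"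
      using U(2)[of x 0] that rho_eq_0[OF S(1), of 0] S(2) by (simp add: ennreal_rho_seminorm N)
    then show ?thesis using e by (simp add: ennreal_le_iff)
  qed
  then have "U \<subseteq> {x. rho_seminorm N x < e}" by (intro subsetI CollectI)
  then show ?thesis by (rule zero_nhd_mono[OF U(1)])
qed

text \<open>Shrinking \<open>N\<close> enlarges \<open>far_set N\<close>, so that decreasing chains of subspaces produce the increasing
  families of axiom (N4).\<close>

definition far_set :: "'a set \<Rightarrow> 'a set" where
  "far_set N = {x. 1 \<le> rho_seminorm N x}"

lemma far_set_closed_gdelta: "gdelta_subspace N \<Longrightarrow> far_set N \<in> closed_gdeltas T"
  unfolding far_set_def
  by (intro seminorm_superlevel_closed_gdelta seminormed_space_rho_seminorm zero_nhd_rho_seminorm)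

lemma far_set_antimono:
  "gdelta_subspace N \<Longrightarrow> gdelta_subspace M \<Longrightarrow> N \<subseteq> M \<Longrightarrow> far_set M \<subseteq> far_set N"
  unfolding far_set_def using rho_seminorm_antimono order_trans by blast

text \<open>The step that uses axiom (N4). Suppose that no closed \<open>G\<^sub>\<delta>\<close> subspace lies below the chain. Then the
  sets \<open>far_set A\<close>, for \<open>A\<close> in the chain, have a dense union: every neighbourhood of zero contains a
  closed \<open>G\<^sub>\<delta>\<close> subspace \<open>N\<close>, some \<open>A\<close> does not contain \<open>N\<close>, and on a line in \<open>N\<close> outside \<open>A\<close> the
  seminorm with kernel \<open>A\<close> is unbounded. By (N4) the values \<open>\<rho> 0 (far_set A)\<close> have infimum zero.
  A sequence of subspaces along which they tend to zero has a closed \<open>G\<^sub>\<delta>\<close> intersection, which is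
  therefore not below the chain; so some \<open>M\<close> in the chain lies below the whole sequence. Then
  \<open>\<rho> 0 (far_set M) = 0\<close>, although zero has distance zero, not at least one, from \<open>M\<close>.\<close>

lemma chain_gdelta_subspace_bounded_below:
  assumes gd: "\<And>A. A \<in> \<C> \<Longrightarrow> gdelta_subspace A"
    and chain: "\<And>A B. A \<in> \<C> \<Longrightarrow> B \<in> \<C> \<Longrightarrow> A \<subseteq> B \<or> B \<subseteq> A"
  shows "\<exists>N. gdelta_subspace N \<and> (\<forall>A\<in>\<C>. N \<subseteq> A)"
proof (rule ccontr)
  assume "\<not> ?thesis"
  then have nb: "\<exists>A\<in>\<C>. \<not> N \<subseteq> A" if "gdelta_subspace N" for N using that by blast
  have gdU: "gdelta_subspace UNIV"
    using UNIV_closed_gdelta subspace_UNIV by (simp add: gdelta_subspace_def)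
  have "A \<subseteq> B \<or> B \<subseteq> A" if "A \<in> far_set ` \<C>" "B \<in> far_set ` \<C>" for A B
    using that chain far_set_antimono gd by (smt (verit) image_iff)
  then obtain W where W: "W \<subseteq> far_set ` \<C>" "\<And>A. A \<in> far_set ` \<C> \<Longrightarrow> \<exists>B\<in>W. A \<subseteq> B"
    and wo: "\<And>G. G \<subseteq> W \<Longrightarrow> G \<noteq> {} \<Longrightarrow> \<exists>C\<in>G. \<forall>D\<in>G. C \<subseteq> D"
    using chain_has_wellordered_cofinal_subset[of "far_set ` \<C>"] by metis
  have W_ne: "W \<noteq> {}" using nb[OF gdU] W(2) by blast
  have W_S: "W \<subseteq> closed_gdeltas T" using W(1) gd far_set_closed_gdelta by blast
  have dense: "T closure_of \<Union>W = UNIV"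
  proof (intro equalityI subsetI UNIV_I)
    fix x
    show "x \<in> T closure_of \<Union>W"
      unfolding in_closure_of
    proof (intro conjI allI impI)
      show "x \<in> topspace T" by (simp add: top)
      fix G assume G: "x \<in> G \<and> openin T G"
      obtain N where N: "gdelta_subspace N" "N \<subseteq> {y. x + y \<in> G}"
        using gdelta_subspace_in_nhd[OF openin_plus[of G x]] G by (metis add.right_neutral mem_Collect_eq)
      obtain A y where A: "A \<in> \<C>" "y \<in> N" "y \<notin> A" using nb[OF N(1)] by blast
      interpret A: seminormed_space nrm sc UNIV "rho_seminorm A"
        by (rule seminormed_space_rho_seminorm[OF gd[OF A(1)]])
      have pos: "0 < rho_seminorm A y"
        using rho_seminorm_eq_0[OF gd[OF A(1)], of y] A(3) rho_seminorm_nonneg[of A y] by linarith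
      obtain l where l: "2 / rho_seminorm A y \<le> nrm l" using large_scalar by blast
      then have l2: "2 \<le> rho_seminorm A (sc l y)" using pos by (simp add: A.p_scale field_simps)
      have "sc l y \<in> N" using N(1) A(2) subspace_scale by (auto simp: gdelta_subspace_def)
      then have mem: "x \<in> G" "x + sc l y \<in> G" using N(2) G by auto
      have "rho_seminorm A (sc l y) \<le> rho_seminorm A (x + sc l y) + rho_seminorm A x"
        using A.p_add[of "x + sc l y" "- x"] by (simp add: A.p_minus)
      then have "x \<in> far_set A \<or> x + sc l y \<in> far_set A"
        using l2 by (auto simp: far_set_def)
      moreover have "far_set A \<subseteq> \<Union>W" using W(2) A(1) by blast
      ultimately show "\<exists>y. y \<in> \<Union>W \<and> y \<in> G" using mem by blast
    qed
  qed
  have "\<rho> 0 UNIV = (INF C\<in>W. \<rho> 0 C)"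
    using rho_Union[OF W_ne W_S wo] UNIV_closed_gdelta by (simp add: dense)
  then have INF0: "(INF C\<in>W. \<rho> 0 C) = 0"
    using rho_eq_0[OF UNIV_closed_gdelta, of 0] by simp
  have "\<exists>N\<in>\<C>. \<rho> 0 (far_set N) < ennreal (1 / real (Suc n))" for n
  proof -
    have "(INF C\<in>W. \<rho> 0 C) < ennreal (1 / real (Suc n))" unfolding INF0 by simp
    then show ?thesis using W(1) unfolding INF_less_iff by blast
  qed
  then obtain N where N: "\<And>n. N n \<in> \<C>" "\<And>n. \<rho> 0 (far_set (N n)) < ennreal (1 / real (Suc n))"
    by metis
  obtain M where M: "M \<in> \<C>" "\<not> (\<Inter>n. N n) \<subseteq> M"
    using nb[OF gdelta_subspace_INT[of N]] gd N(1) by blast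
  have "M \<subseteq> N n" for n using chain[OF M(1) N(1)[of n]] M(2) by blast
  then have "far_set (N n) \<subseteq> far_set M" for n using far_set_antimono gd M(1) N(1) by blast
  then have "\<rho> 0 (far_set M) \<le> \<rho> 0 (far_set (N n))" for n
    using rho_antimono far_set_closed_gdelta gd M(1) N(1) by blast
  then have small: "\<rho> 0 (far_set M) < ennreal (1 / real (Suc n))" for n
    using N(2) le_less_trans by blast
  have "\<rho> 0 (far_set M) \<le> 0 + ennreal e" if "0 < e" for e
  proof -
    obtain n where "1 / real (Suc n) < e" using nat_approx_posE[OF \<open>0 < e\<close>] by auto
    then have "ennreal (1 / real (Suc n)) \<le> ennreal e" by (intro ennreal_leI) simp
    then show ?thesis using small[of n] by simp
  qed
  then have "\<rho> 0 (far_set M) = 0" using ennreal_le_epsilon[of 0 "\<rho> 0 (far_set M)"] by simp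
  then have "0 \<in> far_set M" using rho_eq_0[OF far_set_closed_gdelta[OF gd[OF M(1)]]] by blast
  moreover have "rho_seminorm M 0 = 0"
    using rho_seminorm_eq_0[OF gd[OF M(1)]] gd[OF M(1)] subspace_0 by (simp add: gdelta_subspace_def)
  ultimately show False by (simp add: far_set_def)
qed

text \<open>Zorn's lemma gives a minimal closed \<open>G\<^sub>\<delta>\<close> subspace, which is the least one because the
  intersection of two such subspaces is again one.\<close>

lemma ex_least_gdelta_subspace:
  obtains N0 where "gdelta_subspace N0" "\<And>N. gdelta_subspace N \<Longrightarrow> N0 \<subseteq> N"
proof -
  \<comment> \<open>Complements turn the search for a minimal set into one for a maximal set.\<close>
  let ?A = "uminus ` {N. gdelta_subspace N}"
  have "\<exists>M\<in>?A. \<forall>X\<in>?A. M \<subseteq> X \<longrightarrow> X = M"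
  proof (rule subset_Zorn)
    fix C assume C: "subset.chain ?A C"
    have "gdelta_subspace B" if "B \<in> uminus ` C" for B
      using that C unfolding subset_chain_def by auto
    moreover have "B \<subseteq> B' \<or> B' \<subseteq> B" if B: "B \<in> uminus ` C" "B' \<in> uminus ` C" for B B'
    proof -
      obtain X X' where X: "X \<in> C" "X' \<in> C" "B = - X" "B' = - X'" using B by blast
      then have "X \<subseteq> X' \<or> X' \<subseteq> X" using C unfolding subset_chain_def by blast
      then show ?thesis unfolding X by blast
    qed
    ultimately obtain N where N: "gdelta_subspace N" "\<forall>B\<in>uminus ` C. N \<subseteq> B"
      using chain_gdelta_subspace_bounded_below[of "uminus ` C"] by auto
    show "\<exists>U\<in>?A. \<forall>X\<in>C. X \<subseteq> U"
      using N by (intro bexI[of _ "- N"]) auto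
  qed
  then obtain N0 where N0: "gdelta_subspace N0" "\<And>N. gdelta_subspace N \<Longrightarrow> N \<subseteq> N0 \<Longrightarrow> N = N0"
    by auto
  show thesis
  proof (rule that[OF N0(1)])
    fix N assume N: "gdelta_subspace N"
    \<comment> \<open>A binary intersection as a countable one.\<close>
    have "(\<Inter>n::nat. if n = 0 then N else N0) = N \<inter> N0"
      by (auto split: if_splits)
    then have "gdelta_subspace (N \<inter> N0)"
      using gdelta_subspace_INT[of "\<lambda>n. if n = 0 then N else N0"] N N0(1) by simp
    then show "N0 \<subseteq> N" using N0(2)[of "N \<inter> N0"] by blast
  qed
qed

text \<open>The seminorm \<open>p\<close> with the least kernel \<open>N0\<close> generates the topology. Given a neighbourhood of zero, take
  the closed \<open>G\<^sub>\<delta>\<close> set \<open>C\<close> of \<open>gdelta_subspace_in_nhd\<close> that contains its complement. It is invariant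
  under some closed \<open>G\<^sub>\<delta>\<close> subspace, hence under \<open>N0\<close>, and (N5a) for \<open>C + N0 = C\<close> bounds
  \<open>p x\<close> from below by \<open>\<rho> 0 C > 0\<close> for every \<open>x\<close> in \<open>C\<close>.\<close>

theorem topology_seminormable:
  "\<exists>p. seminormed_space nrm sc UNIV p \<and> T = seminorm_topology UNIV p"
proof -
  obtain N0 where N0: "gdelta_subspace N0" and least: "\<And>N. gdelta_subspace N \<Longrightarrow> N0 \<subseteq> N"
    using ex_least_gdelta_subspace by blast
  define p where "p = rho_seminorm N0"
  interpret p: seminormed_space nrm sc UNIV p
    unfolding p_def by (rule seminormed_space_rho_seminorm[OF N0])
  have "\<exists>e>0. {x \<in> UNIV. p x < e} \<subseteq> W" if W: "zero_nhd T W" for W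
  proof -
    obtain G where G: "openin T G" "0 \<in> G" "G \<subseteq> W" using W by (auto simp: zero_nhd_def)
    obtain N C where NC: "gdelta_subspace N" "C \<in> closed_gdeltas T" "0 \<notin> C" "- G \<subseteq> C"
      "\<And>x y. x \<in> C \<Longrightarrow> y \<in> N \<Longrightarrow> x + y \<in> C"
      using gdelta_subspace_in_nhd[OF G(1,2)] by metis
    have N0': "N0 \<in> closed_gdeltas T" "0 \<in> N0" using N0 subspace_0 by (auto simp: gdelta_subspace_def)
    have "{a + b |a b. a \<in> C \<and> b \<in> N0} = C"
    proof
      show "{a + b |a b. a \<in> C \<and> b \<in> N0} \<subseteq> C" using NC(5) least[OF NC(1)] by blast
      show "C \<subseteq> {a + b |a b. a \<in> C \<and> b \<in> N0}" using N0'(2) by force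
    qed
    moreover have "T closure_of C = C" using NC(2) by (simp add: closed_gdeltas_def closure_of_closedin)
    ultimately have sum: "\<rho> (x + y) C \<le> kplus nrm (\<rho> x C) (\<rho> y N0)" for x y
      using rho_add[OF NC(2) N0'(1), of x y] NC(2) by simp
    have le: "\<rho> 0 C \<le> ennreal (p x)" if "x \<in> C" for x
    proof -
      have "\<rho> x C = 0" using rho_eq_0[OF NC(2)] that by simp
      then have "\<rho> 0 C \<le> \<rho> (- x) N0" using sum[of x "- x"] by (simp add: kplus_zero_left)
      also have "\<dots> = ennreal (p x)"
        using p.p_minus[of x] by (simp add: p_def ennreal_rho_seminorm[OF N0, symmetric])
      finally show ?thesis .
    qed
    have "\<rho> 0 C \<noteq> 0" using rho_eq_0[OF NC(2)] NC(3) by blast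
    then obtain e where e: "0 < e" "ennreal e \<le> \<rho> 0 C"
      by (cases "\<rho> 0 C" rule: ennreal_cases) (auto intro: that[of 1] simp: less_le)
    have "{x \<in> UNIV. p x < e} \<subseteq> W"
    proof
      fix x assume x: "x \<in> {x \<in> UNIV. p x < e}"
      show "x \<in> W"
      proof (rule ccontr)
        assume "x \<notin> W"
        then have "x \<in> C" using G(3) NC(4) by blast
        then have "ennreal e \<le> ennreal (p x)" using le e(2) order_trans by blast
        then show False using x e(1) p.p_nonneg[of x] by (simp add: ennreal_le_iff)
      qed
    qed
    then show ?thesis using e(1) by blast
  qed
  moreover have "zero_nhd T W" if "0 < e" "{x \<in> UNIV. p x < e} \<subseteq> W" for W e
    using zero_nhd_mono[OF zero_nhd_rho_seminorm[OF N0 that(1)]] that(2) by (simp add: p_def)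
  ultimately have "T = seminorm_topology UNIV p"
    by (intro p.eq_seminorm_topologyI tvs top) blast
  then show ?thesis using p.seminormed_space_axioms by blast
qed

end

section \<open>The operator seminorm\<close>

lemma vector_space_op_scale: "vector_space sc \<Longrightarrow> vector_space (op_scale sc)"
  unfolding vector_space_def op_scale_def by (simp add: fun_eq_iff)

locale seminormed_operators = seminormed_space nrm sc UNIV p
  for nrm :: "'k::field \<Rightarrow> real" and sc :: "'k \<Rightarrow> 'a::ab_group_add \<Rightarrow> 'a" and p :: "'a \<Rightarrow> real"
begin

abbreviation "lin \<equiv> Vector_Spaces.linear sc sc"

lemma lin_iff: "lin A \<longleftrightarrow> (\<forall>x y. A (x + y) = A x + A y) \<and> (\<forall>l x. A (sc l x) = sc l (A x))"
  by (simp add: Vector_Spaces.linear_iff vector_space_axioms)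

text \<open>The constant \<open>K\<close> depends only on the radius \<open>r\<close>, not on the operator or on \<open>s\<close>. Hence a small
  \<open>s\<close> makes the bound small uniformly over all operators that map the ball of radius \<open>r\<close> into the
  ball of radius \<open>s\<close>.\<close>

lemma linear_bound_from_ball:
  assumes r: "0 < r"
  shows "\<exists>K>0. \<forall>A s. lin A \<longrightarrow> 0 < s \<longrightarrow> (\<forall>x. p x < r \<longrightarrow> p (A x) < s) \<longrightarrow>
    (\<forall>x. p (A x) \<le> s * K * p x)"
proof -
  obtain c where c: "0 < c" "\<And>t. 0 < t \<Longrightarrow> \<exists>l. l \<noteq> 0 \<and> c * r \<le> nrm l * t \<and> nrm l * t < r"
    using scalar_between[OF r] by blast
  have "p (A x) \<le> s * (1 / (c * r)) * p x"
    if A: "lin A" and s: "0 < s" and b: "\<And>x. p x < r \<Longrightarrow> p (A x) < s" for A s x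
  proof -
    have scaled: "nrm l * p (A x) < s" if "nrm l * p x < r" for l
      using b[of "sc l x"] that A by (simp add: lin_iff p_scale)
    consider "p x = 0" | "0 < p x" using p_nonneg[of x] by fastforce
    then show ?thesis
    proof cases
      case 1
      \<comment> \<open>All multiples of \<open>x\<close> lie in the ball, so \<open>p (A x)\<close> cannot be scaled above \<open>s\<close>.\<close>
      have "\<not> 0 < p (A x)"
      proof
        assume pos: "0 < p (A x)"
        obtain l where "s / p (A x) \<le> nrm l" using large_scalar by blast
        then have "s \<le> nrm l * p (A x)" using pos by (simp add: field_simps)
        then show False using scaled[of l] 1 r by simp
      qed
      then show ?thesis using 1 by simp
    next
      case 2
      obtain l where l: "l \<noteq> 0" "c * r \<le> nrm l * p x" "nrm l * p x < r" using c(2)[OF 2] by blast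
      have "c * r * p (A x) \<le> nrm l * p x * p (A x)"
        using l(2) p_nonneg by (intro mult_right_mono) auto
      also have "\<dots> = nrm l * p (A x) * p x" by simp
      also have "\<dots> \<le> s * p x" using scaled[OF l(3)] 2 by (intro mult_right_mono) auto
      finally show ?thesis using c(1) r by (simp add: field_simps)
    qed
  qed
  then show ?thesis using c(1) r by (intro exI[of _ "1 / (c * r)"]) simp
qed

abbreviation "bounded_ops \<equiv> cont_operators sc (seminorm_topology UNIV p)"

lemma cont_operators_iff_bounded:
  "A \<in> bounded_ops \<longleftrightarrow> lin A \<and> (\<exists>K\<ge>0. \<forall>x. p (A x) \<le> K * p x)"
proof
  assume A: "A \<in> bounded_ops"
  then have lin: "lin A" and cont: "continuous_map Tp Tp A" by (auto simp: cont_operators_def)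
  have "openin Tp {x. p x < 1}" using openin_ball[of 0 1] by simp
  then have "openin Tp {x. p (A x) < 1}"
    using openin_continuous_map_preimage[OF cont, of "{x. p x < 1}"]
    by (simp add: topspace_seminorm_topology)
  moreover have "A 0 = 0" using lin lin_iff[of A] by (metis scale_zero_left)
  then have "0 \<in> {x. p (A x) < 1}" by (simp add: p_0)
  ultimately obtain e where "0 < e" "\<forall>y\<in>UNIV. p (y - 0) < e \<longrightarrow> y \<in> {x. p (A x) < 1}"
    unfolding openin_seminorm_topology by blast
  then have e: "0 < e" "\<And>y. p y < e \<Longrightarrow> p (A y) < 1" by simp_all
  obtain K where "0 < K" "\<forall>A s. lin A \<longrightarrow> 0 < s \<longrightarrow> (\<forall>x. p x < e \<longrightarrow> p (A x) < s) \<longrightarrow>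
    (\<forall>x. p (A x) \<le> s * K * p x)" using linear_bound_from_ball[OF e(1)] by blast
  then have "\<forall>x. p (A x) \<le> K * p x"
    using lin e(2) by (metis mult_1 zero_less_one)
  then show "lin A \<and> (\<exists>K\<ge>0. \<forall>x. p (A x) \<le> K * p x)" using lin \<open>0 < K\<close> by (intro conjI exI[of _ K]) auto
next
  assume "lin A \<and> (\<exists>K\<ge>0. \<forall>x. p (A x) \<le> K * p x)"
  then obtain K where lin: "lin A" and K: "0 \<le> K" "\<And>x. p (A x) \<le> K * p x" by blast
  have "continuous_map Tp Tp A"
    unfolding continuous_map_def topspace_seminorm_topology
  proof (intro conjI allI impI)
    fix G assume G: "openin Tp G"
    show "openin Tp {x \<in> UNIV. A x \<in> G}"
      unfolding openin_seminorm_topology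
    proof (intro conjI ballI)
      fix x assume "x \<in> {x \<in> UNIV. A x \<in> G}"
      then obtain e where e: "e > 0" "\<And>y. p (y - A x) < e \<Longrightarrow> y \<in> G"
        using G unfolding openin_seminorm_topology by blast
      have "A y \<in> G" if y: "p (y - x) < e / (K + 1)" for y
      proof (rule e(2))
        have "A (y - x) + A x = A y" using lin unfolding lin_iff by (metis diff_add_cancel)
        then have "p (A y - A x) = p (A (y - x))" by (metis add_diff_cancel_right')
        also have "\<dots> \<le> (K + 1) * p (y - x)"
          using K(2)[of "y - x"] p_nonneg[of "y - x"] by (simp add: distrib_right)
        also have "\<dots> < e" using y K(1) by (simp add: field_simps)
        finally show "p (A y - A x) < e" .
      qed
      then show "\<exists>e>0. \<forall>y\<in>UNIV. p (y - x) < e \<longrightarrow> y \<in> {x \<in> UNIV. A x \<in> G}"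
        using e(1) K(1) by (intro exI[of _ "e / (K + 1)"]) auto
    qed auto
  qed auto
  then show "A \<in> bounded_ops" using lin by (simp add: cont_operators_def)
qed

definition op_seminorm :: "('a \<Rightarrow> 'a) \<Rightarrow> real" where
  "op_seminorm A = Inf {K. 0 \<le> K \<and> (\<forall>x. p (A x) \<le> K * p x)}"

lemma op_seminorm_le: "0 \<le> K \<Longrightarrow> (\<And>x. p (A x) \<le> K * p x) \<Longrightarrow> op_seminorm A \<le> K"
  unfolding op_seminorm_def by (rule cInf_lower) (auto intro: bdd_belowI[of _ 0])

lemma op_seminorm_nonneg: "A \<in> bounded_ops \<Longrightarrow> 0 \<le> op_seminorm A"
  unfolding op_seminorm_def cont_operators_iff_bounded by (rule cInf_greatest) auto

lemma op_seminorm_bound: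
  assumes A: "A \<in> bounded_ops"
  shows "p (A x) \<le> op_seminorm A * p x"
proof -
  obtain K where K: "0 \<le> K" "\<And>x. p (A x) \<le> K * p x"
    using A by (auto simp: cont_operators_iff_bounded)
  consider "p x = 0" | "0 < p x" using p_nonneg[of x] by fastforce
  then show ?thesis
  proof cases
    case 1
    then show ?thesis using K(2)[of x] by simp
  next
    case 2
    have "p (A x) / p x \<le> op_seminorm A"
      unfolding op_seminorm_def using K 2
      by (intro cInf_greatest) (auto simp: pos_divide_le_eq)
    then show ?thesis using 2 by (simp add: pos_divide_le_eq)
  qed
qed

lemma op_seminorm_scale_le:
  assumes "A \<in> bounded_ops"
  shows "op_seminorm (op_scale sc l A) \<le> nrm l * op_seminorm A"
proof (rule op_seminorm_le)
  show "0 \<le> nrm l * op_seminorm A" using assms nrm_nonneg op_seminorm_nonneg by simp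
  show "p (op_scale sc l A x) \<le> nrm l * op_seminorm A * p x" for x
    using mult_left_mono[OF op_seminorm_bound[OF assms, of x] nrm_nonneg[of l]]
    by (simp add: op_scale_def p_scale mult.assoc)
qed

lemma op_scale_bounded: "A \<in> bounded_ops \<Longrightarrow> op_scale sc l A \<in> bounded_ops"
  unfolding cont_operators_iff_bounded
proof (elim conjE exE, intro conjI)
  fix K assume A: "lin A" and K: "0 \<le> K" "\<forall>x. p (A x) \<le> K * p x"
  show "lin (op_scale sc l A)"
    using A by (simp add: lin_iff op_scale_def scale_right_distrib mult.commute)
  have "p (op_scale sc l A x) \<le> nrm l * K * p x" for x
    using mult_left_mono[OF K(2)[rule_format, of x] nrm_nonneg[of l]]
    by (simp add: op_scale_def p_scale mult.assoc)
  then show "\<exists>K\<ge>0. \<forall>x. p (op_scale sc l A x) \<le> K * p x"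
    using K(1) nrm_nonneg[of l] by (intro exI[of _ "nrm l * K"]) simp
qed

lemma op_seminorm_add_pointwise:
  assumes "A \<in> bounded_ops" "B \<in> bounded_ops"
  shows "p ((A + B) x) \<le> real_kplus nrm (op_seminorm A) (op_seminorm B) * p x"
proof -
  have "p ((A + B) x) \<le> real_kplus nrm (p (A x)) (p (B x))" using p_add_kplus by simp
  also have "\<dots> \<le> real_kplus nrm (op_seminorm A * p x) (op_seminorm B * p x)"
    using assms by (intro real_kplus_mono op_seminorm_bound)
  finally show ?thesis using p_nonneg[of x] by (simp add: real_kplus_mult_right)
qed

sublocale ops: seminormed_space nrm "op_scale sc" bounded_ops op_seminorm
proof -
  interpret v: vector_space "op_scale sc" by (rule vector_space_op_scale[OF vector_space_axioms])
  show "seminormed_space nrm (op_scale sc) bounded_ops op_seminorm"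
  proof unfold_locales
    show "v.subspace bounded_ops"
    proof (rule v.subspaceI)
      show "0 \<in> bounded_ops"
        unfolding cont_operators_iff_bounded by (auto simp: lin_iff p_0 intro!: exI[of _ 0])
      show "A + B \<in> bounded_ops" if AB: "A \<in> bounded_ops" "B \<in> bounded_ops" for A B
        unfolding cont_operators_iff_bounded
      proof
        show "lin (A + B)"
          using AB by (simp add: cont_operators_def lin_iff scale_right_distrib algebra_simps)
        show "\<exists>K\<ge>0. \<forall>x. p ((A + B) x) \<le> K * p x"
          using op_seminorm_add_pointwise[OF AB] AB op_seminorm_nonneg real_kplus_nonneg by blast
      qed
      show "op_scale sc l A \<in> bounded_ops" if "A \<in> bounded_ops" for l A
        using that by (rule op_scale_bounded)
    qed
    fix A B l assume A: "A \<in> bounded_ops"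
    show "0 \<le> op_seminorm A" using A by (rule op_seminorm_nonneg)
    show "op_seminorm (op_scale sc l A) = nrm l * op_seminorm A"
    proof (cases "l = 0")
      case True
      then show ?thesis
        using op_seminorm_scale_le[OF A, of l] op_seminorm_nonneg[OF op_scale_bounded[OF A, of l]]
        by (simp add: nrm_0)
    next
      case False
      have "op_scale sc (inverse l) (op_scale sc l A) = A" using False by (simp add: op_scale_def)
      then have "op_seminorm A \<le> nrm (inverse l) * op_seminorm (op_scale sc l A)"
        using op_seminorm_scale_le[OF op_scale_bounded[OF A, of l], of "inverse l"] by simp
      also have "\<dots> = op_seminorm (op_scale sc l A) / nrm l"
        unfolding nrm_inverse[OF False] by (simp add: field_simps)
      finally have "nrm l * op_seminorm A \<le> op_seminorm (op_scale sc l A)"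
        using nrm_pos[OF False] by (simp add: field_simps)
      then show ?thesis using op_seminorm_scale_le[OF A, of l] by simp
    qed
    assume B: "B \<in> bounded_ops"
    show "op_seminorm (A + B) \<le> real_kplus nrm (op_seminorm A) (op_seminorm B)"
      using op_seminorm_add_pointwise[OF A B] A B
      by (intro op_seminorm_le real_kplus_nonneg op_seminorm_nonneg)
  qed
qed

lemma seminorm_ball_subset_op_nhd:
  assumes U: "\<And>x. x \<in> U \<Longrightarrow> p x \<le> R" and R: "0 < R" and V: "{x. p x < s} \<subseteq> V"
  shows "{A \<in> bounded_ops. op_seminorm A < s / R} \<subseteq> op_nhd sc Tp U V"
proof
  fix A assume "A \<in> {A \<in> bounded_ops. op_seminorm A < s / R}"
  then have A: "A \<in> bounded_ops" "op_seminorm A < s / R" by auto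
  have "p (A x) < s" if x: "x \<in> U" for x
  proof -
    have "p (A x) \<le> op_seminorm A * R"
      using op_seminorm_bound[OF A(1), of x] mult_left_mono[OF U[OF x] op_seminorm_nonneg[OF A(1)]]
      by simp
    also have "\<dots> < s" using A(2) R by (simp add: pos_less_divide_eq)
    finally show ?thesis .
  qed
  then show "A \<in> op_nhd sc Tp U V" using A(1) V by (auto simp: op_nhd_def)
qed

lemma op_nhd_subset_seminorm_ball:
  assumes r: "0 < r" and e: "0 < e"
  shows "\<exists>s>0. \<forall>U V. {x. p x < r} \<subseteq> U \<longrightarrow> V \<subseteq> {x. p x < s} \<longrightarrow>
    op_nhd sc Tp U V \<subseteq> {A \<in> bounded_ops. op_seminorm A < e}"
proof -
  obtain K where K: "0 < K" "\<And>A s x. lin A \<Longrightarrow> 0 < s \<Longrightarrow> (\<And>x. p x < r \<Longrightarrow> p (A x) < s) \<Longrightarrow>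
    p (A x) \<le> s * K * p x" using linear_bound_from_ball[OF r] by blast
  define s where "s = e / (2 * K)"
  have s: "0 < s" "s * K = e / 2" using K(1) e by (auto simp: s_def)
  have "op_nhd sc Tp U V \<subseteq> {A \<in> bounded_ops. op_seminorm A < e}"
    if UV: "{x. p x < r} \<subseteq> U" "V \<subseteq> {x. p x < s}" for U V
  proof
    fix A assume A: "A \<in> op_nhd sc Tp U V"
    then have "lin A" "A \<in> bounded_ops" by (auto simp: op_nhd_def cont_operators_def)
    moreover have "p (A x) < s" if "p x < r" for x using A UV that by (auto simp: op_nhd_def)
    then have "op_seminorm A \<le> s * K"
      using s K \<open>lin A\<close> by (intro op_seminorm_le K(2)) auto
    ultimately show "A \<in> {A \<in> bounded_ops. op_seminorm A < e}" using s e by simp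
  qed
  then show ?thesis using s(1) by blast
qed

lemma operator_topology_seminorm_topology:
  "operator_topology nrm sc Tp {{x. p x < r} |r. 0 < r} ops.Tp"
  unfolding operator_topology_def
proof (intro conjI)
  show "zero_nhd_base Tp {{x. p x < r} |r. 0 < r}"
    by (auto simp: zero_nhd_base_def zero_nhd_seminorm_topology)
  show "topspace ops.Tp = bounded_ops" by (rule topspace_seminorm_topology)
  show "topological_vector_space nrm (op_scale sc) ops.Tp"
    by (rule ops.topological_vector_space_seminorm_topology)
  show "zero_nhd_base ops.Tp
    {op_nhd sc Tp U V |U V. U \<in> {{x. p x < r} |r. 0 < r} \<and> V \<in> {{x. p x < r} |r. 0 < r}}"
    unfolding zero_nhd_base_def
  proof (intro conjI ballI allI impI)
    fix W assume "W \<in> {op_nhd sc Tp U V |U V. U \<in> {{x. p x < r} |r. 0 < r} \<and> V \<in> {{x. p x < r} |r. 0 < r}}"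
    then obtain r s where rs: "0 < r" "0 < s" "W = op_nhd sc Tp {x. p x < r} {x. p x < s}" by blast
    have "{A \<in> bounded_ops. op_seminorm A < s / r} \<subseteq> W"
      unfolding rs(3) using rs(1) by (intro seminorm_ball_subset_op_nhd) auto
    moreover have "W \<subseteq> bounded_ops" by (auto simp: rs(3) op_nhd_def)
    ultimately show "zero_nhd ops.Tp W"
      using rs(1,2) unfolding ops.zero_nhd_seminorm_topology
      by (intro conjI exI[of _ "s / r"]) auto
  next
    fix G assume "zero_nhd ops.Tp G"
    then obtain e where e: "0 < e" "{A \<in> bounded_ops. op_seminorm A < e} \<subseteq> G"
      unfolding ops.zero_nhd_seminorm_topology by blast
    obtain s where "0 < s" "op_nhd sc Tp {x. p x < 1} {x. p x < s} \<subseteq> {A \<in> bounded_ops. op_seminorm A < e}"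
      using op_nhd_subset_seminorm_ball[of 1 e] e(1) by auto
    then show "\<exists>U\<in>{op_nhd sc Tp U V |U V. U \<in> {{x. p x < r} |r. 0 < r} \<and> V \<in> {{x. p x < r} |r. 0 < r}}. U \<subseteq> G"
      using e(2) by (intro bexI[of _ "op_nhd sc Tp {x. p x < 1} {x. p x < s}"]) (auto intro: zero_less_one)
  qed
qed

text \<open>Every admissible base \<open>\<V>\<close> gives the topology of the operator seminorm. The point is that
  all members of \<open>\<V>\<close> are bounded: since scalar multiplication is continuous in the vector
  topology \<open>TO\<close>, small multiples of the identity lie in \<open>op_nhd sc Tp U V\<close> for \<open>U\<close> and \<open>V\<close> in \<open>\<V>\<close>, that is,
  small multiples of \<open>U\<close> lie in \<open>V\<close>.\<close>

lemma operator_topology_unique: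
  assumes TO: "operator_topology nrm sc Tp \<V> TO"
  shows "TO = ops.Tp"
proof (rule ops.eq_seminorm_topologyI)
  have base: "zero_nhd_base Tp \<V>" and top: "topspace TO = bounded_ops"
    and tvs: "topological_vector_space nrm (op_scale sc) TO"
    and op_base: "zero_nhd_base TO {op_nhd sc Tp U V |U V. U \<in> \<V> \<and> V \<in> \<V>}"
    using TO by (auto simp: operator_topology_def)
  show "topological_vector_space nrm (op_scale sc) TO" "topspace TO = bounded_ops" by fact+
  have ball: "\<exists>V\<in>\<V>. V \<subseteq> {x. p x < s}" if s: "0 < s" for s
  proof -
    have "zero_nhd Tp {x. p x < s}" using s by (auto simp: zero_nhd_seminorm_topology)
    then show ?thesis using base by (simp add: zero_nhd_base_def)
  qed
  have contains_ball: "\<exists>r>0. {x. p x < r} \<subseteq> U" if U: "U \<in> \<V>" for U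
  proof -
    have "zero_nhd Tp U" using base U by (simp add: zero_nhd_base_def)
    then show ?thesis by (simp add: zero_nhd_seminorm_topology)
  qed
  have nhd: "zero_nhd TO (op_nhd sc Tp U V)" if "U \<in> \<V>" "V \<in> \<V>" for U V
    using op_base that unfolding zero_nhd_base_def by blast
  have bounded: "\<exists>R>0. \<forall>x\<in>U. p x \<le> R" if U: "U \<in> \<V>" for U
  proof -
    obtain V where V: "V \<in> \<V>" "V \<subseteq> {x. p x < 1}" using ball[of 1] by auto
    obtain G where G: "openin TO G" "0 \<in> G" "G \<subseteq> op_nhd sc Tp U V"
      using nhd[OF U V(1)] by (auto simp: zero_nhd_def)
    have id: "id \<in> topspace TO"
      unfolding top cont_operators_iff_bounded by (auto simp: lin_iff intro!: exI[of _ 1])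
    have "op_scale sc 0 id = 0" by (simp add: op_scale_def fun_eq_iff)
    then have 0: "op_scale sc 0 id \<in> G" using G(2) by simp
    obtain d H where d: "0 < d" "openin TO H" "id \<in> H"
      "\<And>m A. nrm (m - 0) < d \<Longrightarrow> A \<in> H \<Longrightarrow> op_scale sc m A \<in> G"
      using scale_nhd[where sc = "op_scale sc" and l = 0 and x = id, OF tvs G(1) id 0] by metis
    obtain m where m: "m \<noteq> 0" "nrm m < d" using small_scalar[OF d(1)] by blast
    then have "op_scale sc m id \<in> op_nhd sc Tp U V" using d(3) d(4)[of m id] G(3) by auto
    then have "p (sc m x) < 1" if "x \<in> U" for x
      using that V(2) by (auto simp: op_nhd_def op_scale_def)
    then have "p x \<le> 1 / nrm m" if "x \<in> U" for x
      using that nrm_pos[OF m(1)] by (fastforce simp: p_scale field_simps)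
    then show ?thesis using nrm_pos[OF m(1)] by (intro exI[of _ "1 / nrm m"]) simp
  qed
  fix W
  show "zero_nhd TO W \<longleftrightarrow> W \<subseteq> bounded_ops \<and> (\<exists>e>0. {A \<in> bounded_ops. op_seminorm A < e} \<subseteq> W)"
  proof (intro iffI conjI)
    assume W: "zero_nhd TO W"
    then show "W \<subseteq> bounded_ops" by (simp add: zero_nhd_def top)
    obtain U V where UV: "U \<in> \<V>" "V \<in> \<V>" "op_nhd sc Tp U V \<subseteq> W"
      using op_base W unfolding zero_nhd_base_def by blast
    obtain R where R: "0 < R" "\<forall>x\<in>U. p x \<le> R" using bounded[OF UV(1)] by blast
    obtain s where s: "0 < s" "{x. p x < s} \<subseteq> V" using contains_ball[OF UV(2)] by blast
    have "{A \<in> bounded_ops. op_seminorm A < s / R} \<subseteq> W"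
      using seminorm_ball_subset_op_nhd[of U R s V] R s(2) UV(3) by blast
    then show "\<exists>e>0. {A \<in> bounded_ops. op_seminorm A < e} \<subseteq> W"
      using R(1) s(1) by (intro exI[of _ "s / R"]) simp
  next
    assume "W \<subseteq> bounded_ops \<and> (\<exists>e>0. {A \<in> bounded_ops. op_seminorm A < e} \<subseteq> W)"
    then obtain e where W: "W \<subseteq> bounded_ops" "0 < e" "{A \<in> bounded_ops. op_seminorm A < e} \<subseteq> W"
      by blast
    obtain U where U: "U \<in> \<V>" using ball[of 1] by auto
    obtain r where r: "0 < r" "{x. p x < r} \<subseteq> U" using contains_ball[OF U] by blast
    obtain s where s: "0 < s" "\<And>V. V \<subseteq> {x. p x < s} \<Longrightarrow>
        op_nhd sc Tp U V \<subseteq> {A \<in> bounded_ops. op_seminorm A < e}"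
      using op_nhd_subset_seminorm_ball[OF r(1) W(2)] r(2) by meson
    obtain V where V: "V \<in> \<V>" "V \<subseteq> {x. p x < s}" using ball[OF s(1)] by blast
    have "op_nhd sc Tp U V \<subseteq> W" using s(2)[OF V(2)] W(3) by (rule subset_trans)
    then show "zero_nhd TO W" using nhd[OF U V(1)] W(1) unfolding zero_nhd_def top by (meson subset_trans)
  qed
qed

lemma linear_homeos_subset: "linear_homeos sc Tp \<subseteq> bounded_ops"
  by (auto simp: linear_homeos_def cont_operators_def homeomorphic_imp_continuous_map)

end

section \<open>Real, complex and non-Archimedean scalars\<close>

lemma isometric_field_iso_valued_field:
  fixes \<phi> :: "'k::field \<Rightarrow> 'r::real_normed_field"
  assumes "isometric_field_iso nrm \<phi>"
  shows "valued_field nrm"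
proof
  have bij: "bij \<phi>" and add: "\<And>x y. \<phi> (x + y) = \<phi> x + \<phi> y" and mult: "\<And>x y. \<phi> (x * y) = \<phi> x * \<phi> y"
    and nrm: "\<And>x. nrm x = norm (\<phi> x)"
    using assms by (auto simp: isometric_field_iso_def)
  have 0: "\<phi> 0 = 0" using add[of 0 0] by simp
  then have eq0: "\<phi> x = 0 \<longleftrightarrow> x = 0" for x using bij by (metis bij_is_inj injD)
  show "absolute_value nrm"
    by (simp add: absolute_value_def nrm add mult eq0 norm_mult norm_triangle_ineq)
  obtain l where l: "\<phi> l = of_real (1 / 2)" using bij by (metis bij_pointE)
  have "nrm l = 1 / 2" unfolding nrm l norm_of_real by simp
  moreover from this have "l \<noteq> 0" using nrm[of 0] 0 by auto
  ultimately show "\<exists>l. l \<noteq> 0 \<and> nrm l < 1" by (intro exI[of _ l]) simp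
qed

lemma nonarch_sph_complete_field_valued_field:
  assumes "nonarch_sph_complete_field nrm"
  shows "valued_field nrm"
proof
  show av: "absolute_value nrm" using assms by (simp add: nonarch_sph_complete_field_def)
  have mult: "nrm (x * y) = nrm x * nrm y" and eq0: "nrm x = 0 \<longleftrightarrow> x = 0" and nn: "0 \<le> nrm x" for x y
    using av by (auto simp: absolute_value_def)
  obtain x where x: "x \<noteq> 0" "nrm x \<noteq> 1"
    using assms by (auto simp: nonarch_sph_complete_field_def)
  have "nrm 1 = 1" using mult[of 1 1] eq0[of 1] by simp
  then have inv: "nrm x * nrm (inverse x) = 1" using mult[of x "inverse x"] x(1) by simp
  show "\<exists>l. l \<noteq> 0 \<and> nrm l < 1"
  proof (cases "nrm x < 1")
    case True
    then show ?thesis using x(1) by blast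
  next
    case False
    then have "1 < nrm x" using x(2) by simp
    then have "nrm (inverse x) < 1" using inv nn[of "inverse x"] by (smt (verit) mult_less_cancel_right1 mult_nonneg_nonneg)
    then show ?thesis using x(1) by (intro exI[of _ "inverse x"]) simp
  qed
qed

theorem theorem2p6:
  fixes nrm :: "'k::field \<Rightarrow> real"
    and sc :: "'k \<Rightarrow> 'x::ab_group_add \<Rightarrow> 'x"
    and T :: "'x topology"
  assumes "is_real_field nrm \<or> is_complex_field nrm \<or> nonarch_sph_complete_field nrm"
    and "topspace T = UNIV"
    and "locally_convex_space nrm sc T"
    and "kappa_normable nrm sc T"
  shows "(\<exists>\<V> TO. operator_topology nrm sc T \<V> TO) \<and>
         (\<forall>\<V> TO. operator_topology nrm sc T \<V> TO \<longrightarrow>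
            conditionally_kappa_normable nrm (op_scale sc) TO (linear_homeos sc T))"
proof -
  have vf: "valued_field nrm"
    using assms(1) unfolding is_real_field_def is_complex_field_def
    by (elim disjE exE) (erule isometric_field_iso_valued_field nonarch_sph_complete_field_valued_field)+
  have tvs: "topological_vector_space nrm sc T" using assms(3) by (simp add: locally_convex_space_def)
  obtain \<rho> where "kappa_norm_on nrm sc T UNIV \<rho>" using assms(2,4) by (auto simp: kappa_normable_def)
  then have "kappa_normed_tvs nrm sc T \<rho>"
    using vf tvs assms(2)
    by (simp add: kappa_normed_tvs_def kappa_normed_tvs_axioms_def tvs_def tvs_axioms_def
        topological_vector_space_def)
  then obtain p where p: "seminormed_space nrm sc UNIV p" and T: "T = seminorm_topology UNIV p"
    using kappa_normed_tvs.topology_seminormable by blast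
  interpret seminormed_operators nrm sc p using p by (rule seminormed_operators.intro)
  show ?thesis
    unfolding T conditionally_kappa_normable_def
    using operator_topology_seminorm_topology operator_topology_unique
      ops.kappa_norm_on_seminorm_dist[OF linear_homeos_subset]
    by blast
qed

end
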